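(* Let $a_1,a_2$ be positive integers and let $\lambda=(a_1+a_2,a_1,0)$. If $a_1\ge a_2$, then the Newton–Okounkov body $\Delta(\mathrm{Pet}_3,R(W_\lambda),\nu)\subset\mathbb{R}^2$ is the convex hull of the points $$(0,0),\quad(2a_2+a_1,0),\quad(0,a_1+a_2),\quad(3a_2,a_1-a_2).$$ If $a_2\ge a_1$, then $\Delta(\mathrm{Pet}_3,R(W_\lambda),\nu)$ is the convex hull of the points $$(0,0),\quad(0,a_1+a_2),\quad(2a_1+a_2,0),\quad(3a_1,a_2-a_1).$$
   Context: Let $B\subset\mathrm{GL}_3(\mathbb{C})$ be the upper-triangular matrices, $\mathrm{Flags}(\mathbb{C}^3)=\mathrm{GL}_3(\mathbb{C})/B$, and let $N$ be the $3\times3$ nilpotent matrix with $1$'s on the superdiagonal and $0$'s elsewhere. The Peterson variety is the surface $\mathrm{Pet}_3=\{MB\in\mathrm{GL}_3(\mathbb{C})/B\mid (M^{-1}NM)_{3,1}=0\}$ (equivalently flags with $NV_1\subseteq V_2$), with its reduced structure. It is irreducible of dimension $2$. The open subset $\mathrm{Pet}_3^\circ\subset\mathrm{Pet}_3$ consisting of the cosets $$\begin{pmatrix} y & x & 1 \\ x & 1 & 0 \\ 1 & 0 & 0 \end{pmatrix}B,\qquad x,y\in\mathbb{C},$$ is isomorphic to $\mathbb{A}^2$ with coordinates $x,y$, so the rational function field of $\mathrm{Pet}_3$ is $\mathbb{C}(x,y)$. Valuation: $\nu$ is the valuation $\mathbb{C}(x,y)\setminus\{0\}\to\mathbb{Z}^2$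 associated with the flag $\mathrm{Pet}_3^\circ\supset\{x=0\}\supset\{x=y=0\}$. That is, $\nu$ is the lowest-term valuation for lexicographic order with $x>y$: for a nonzero polynomial $f=\sum c_{\alpha,\beta}x^\alpha y^\beta$, $\nu(f)$ is the lexicographically smallest $(\alpha,\beta)$ (comparing $\alpha$ first) with $c_{\alpha,\beta}\ne0$, and $\nu(f/g)=\nu(f)-\nu(g)$. Line bundle: for $\lambda=(\lambda_1,\lambda_2,\lambda_3)=(a_1+a_2,a_1,0)$, $L_\lambda=(L_1^* )^{\lambda_1}\otimes(L_2^* )^{\lambda_2}\otimes(L_3^* )^{\lambda_3}$ on $\mathrm{Flags}(\mathbb{C}^3)$, where $L_i$ has fiber $V_i/V_{i-1}$ at a flag $V_\bullet$ (this is the pullback of $\mathcal{O}(1)$ under the Plücker embedding into $\mathbb{P}(V_\lambda)$, $V_\lambda$ the irreducible $\mathrm{GL}_3(\mathbb{C})$-representation of highest weight $\lambda$). $W_\lambda$ is the image of the restriction map $H^0(\mathrm{Flags}(\mathbb{C}^3),L_\lambda)\to H^0(\mathrm{Pet}_3,L_\lambda|_{\mathrm{Pet}_3})$. For $k\ge1$ let $W_\lambda^k\subset H^0(\mathrm{Pet}_3,L_\lambda^{\otimes k}|_{\mathrm{Pet}_3})$ be the span of $k$-fold products of elements of $W_\lambda$, and $R(W_\lambda)=\bigoplus_{k\ge0}W_\lambda^k$ (with $W_\lambda^0=\mathbb{C}$). Newton–Okounkov body: let $\tau$ be a nowhere vanishing section of $L_\lambda$ over $\mathrm{Pet}_3^\circ\cong\mathbb{A}^2$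 (unique up to a nonzero constant). For $\sigma\in W_\lambda^k$, $\sigma/\tau^k$ is a polynomial in $x,y$. Then $$\Delta(\mathrm{Pet}_3,R(W_\lambda),\nu)=\overline{\mathrm{conv}\Big(\bigcup_{k\ge1}\Big\{\tfrac1k\,\nu(\sigma/\tau^k)\ \Big|\ 0\ne\sigma\in W_\lambda^k\Big\}\Big)}\subset\mathbb{R}^2.$$ *)

theory Defs
  imports
    "HOL-Analysis.Analysis"
    "HOL-Library.Function_Algebras"
    "HOL-Computational_Algebra.Polynomial"
    "HOL-Computational_Algebra.Fraction_Field"
begin

section \<open>The flag variety and the Peterson variety\<close>

definition GL3 :: "(complex^3^3) set" where
  "GL3 = {M. invertible M}"

definition Borel3 :: "(complex^3^3) set" where
  "Borel3 = {b \<in> GL3. b $ 2 $ 1 = 0 \<and> b $ 3 $ 1 = 0 \<and> b $ 3 $ 2 = 0}"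

definition flag_of :: "complex^3^3 \<Rightarrow> (complex^3^3) set" where
  "flag_of M = (\<lambda>b. M ** b) ` Borel3"

text \<open>
  A point of \<open>GL3 / Borel3\<close> is a coset, so for a set \<open>X\<close> of flags the union \<open>\<Union>X\<close> is the preimage
  of \<open>X\<close> under the quotient map from \<open>GL3\<close>. The coset of \<open>M\<close> is the flag
  whose \<open>i\<close>-th subspace \<open>V\<^sub>i\<close> is spanned by the first \<open>i\<close> columns of \<open>M\<close>.
\<close>

definition Flags3 :: "(complex^3^3) set set" where
  "Flags3 = flag_of ` GL3"

definition nilp3 :: "complex^3^3" where
  "nilp3 = vector [vector [0, 1, 0], vector [0, 0, 1], vector [0, 0, 0]]"

definition Pet3 :: "(complex^3^3) set set" where
  "Pet3 = {flag_of M | M. M \<in> GL3 \<and> (matrix_inv M ** nilp3 ** M) $ 3 $ 1 = 0}"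

definition chart :: "complex \<Rightarrow> complex \<Rightarrow> complex^3^3" where
  "chart x y = vector [vector [y, x, 1], vector [x, 1, 0], vector [1, 0, 0]]"

definition Pet3_open :: "(complex^3^3) set set" where
  "Pet3_open = {flag_of (chart x y) | x y. True}"


section \<open>Sections of the line bundles\<close>

text \<open>Polynomials in the nine matrix entries, regarded as functions.\<close>

inductive_set matrix_polys :: "(complex^3^3 \<Rightarrow> complex) set" where
  const: "(\<lambda>M. c) \<in> matrix_polys"
| entry: "(\<lambda>M. M $ i $ j) \<in> matrix_polys"
| add: "p \<in> matrix_polys \<Longrightarrow> q \<in> matrix_polys \<Longrightarrow> (\<lambda>M. p M + q M) \<in> matrix_polys"
| mult: "p \<in> matrix_polys \<Longrightarrow> q \<in> matrix_polys \<Longrightarrow> (\<lambda>M. p M * q M) \<in> matrix_polys"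

text \<open>The coordinate ring of the affine variety \<open>GL3\<close>: polynomials in the entries and \<open>1 / det\<close>.\<close>

definition regular_GL3 :: "(complex^3^3 \<Rightarrow> complex) \<Rightarrow> bool" where
  "regular_GL3 f \<longleftrightarrow> (\<exists>p\<in>matrix_polys. \<exists>n. \<forall>M\<in>GL3. f M = p M / det M ^ n)"

text \<open>
  At the flag of \<open>M\<close> the line \<open>V\<^sub>i / V\<^sub>i\<^sub>-\<^sub>1\<close> is spanned by the class of the \<open>i\<close>-th column of \<open>M\<close>.
  Evaluating a section of \<open>L\<^sub>\<lambda> = \<Otimes>\<^sub>i (L\<^sub>i\<^sup>*)\<^sup>\<lambda>\<^sup>i\<close> on the tensor product of
  these classes turns it into a function \<open>s\<close> of \<open>M\<close>. Replacing \<open>M\<close> by \<open>M ** b\<close> multiplies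
  the \<open>i\<close>-th class by \<open>b $ i $ i\<close>. Hence sections of \<open>L\<^sub>\<lambda>\<close> over \<open>X\<close> are the functions on \<open>\<Union>X\<close> with
  \<open>s (M ** b) = (\<Prod>i. (b $ i $ i) ^ \<lambda>\<^sub>i) * s M\<close>, subject to regularity.
\<close>

definition weight_char :: "nat^3 \<Rightarrow> complex^3^3 \<Rightarrow> complex" where
  "weight_char lam b = (\<Prod>i\<in>UNIV. (b $ i $ i) ^ (lam $ i))"

definition equivariant_on :: "(complex^3^3) set set \<Rightarrow> nat^3 \<Rightarrow> (complex^3^3 \<Rightarrow> complex) \<Rightarrow> bool" where
  "equivariant_on X lam s \<longleftrightarrow> (\<forall>M\<in>\<Union>X. \<forall>b\<in>Borel3. s (M ** b) = weight_char lam b * s M)"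

text \<open>
  Functions on \<open>\<Union>X\<close> are represented by functions vanishing off \<open>\<Union>X\<close>, so that equality of
  sections is equality in HOL. As \<open>Pet3\<close> is reduced, its sections are determined by their values.
\<close>

definition restrict_to :: "(complex^3^3) set set \<Rightarrow> (complex^3^3 \<Rightarrow> complex) \<Rightarrow> complex^3^3 \<Rightarrow> complex" where
  "restrict_to X s = (\<lambda>M. if M \<in> \<Union>X then s M else 0)"

definition H0_Flags3 :: "nat^3 \<Rightarrow> (complex^3^3 \<Rightarrow> complex) set" where
  "H0_Flags3 lam = {s. regular_GL3 s \<and> equivariant_on Flags3 lam s \<and> restrict_to Flags3 s = s}"

definition W_sections :: "nat^3 \<Rightarrow> (complex^3^3 \<Rightarrow> complex) set" where
  "W_sections lam = restrict_to Pet3 ` H0_Flags3 lam"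

interpretation fun_space: vector_space "\<lambda>(c::complex) (s::complex^3^3 \<Rightarrow> complex) M. c * s M"
  by unfold_locales (auto simp: algebra_simps plus_fun_def)

text \<open>The graded piece \<open>W\<^sub>\<lambda>\<^sup>k\<close> of \<open>R(W\<^sub>\<lambda>)\<close>; for \<open>k = 0\<close> these are the constants on \<open>Pet3\<close>.\<close>

definition R_W :: "nat^3 \<Rightarrow> nat \<Rightarrow> (complex^3^3 \<Rightarrow> complex) set" where
  "R_W lam k = fun_space.span
     {restrict_to Pet3 (\<lambda>M. \<Prod>i<k. s i M) | s. \<forall>i<k. s i \<in> W_sections lam}"


section \<open>The valuation\<close>

text \<open>
  The polynomial ring in \<open>x\<close> and \<open>y\<close> is \<open>complex poly poly\<close> with \<open>x\<close> the outer variable: the coefficient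
  of \<open>x\<^sup>i y\<^sup>j\<close> in \<open>f\<close> is \<open>coeff (coeff f i) j\<close>. Its fraction field is \<open>complex poly poly fract\<close>.
\<close>

definition eval_xy :: "complex poly poly \<Rightarrow> complex \<Rightarrow> complex \<Rightarrow> complex" where
  "eval_xy f x y = poly (poly f [:x:]) y"

text \<open>The lexicographically smallest exponent of a nonzero polynomial.\<close>

definition low_exp :: "complex poly poly \<Rightarrow> int \<times> int" where
  "low_exp f =
     (let i = (LEAST i. \<exists>j. coeff (coeff f i) j \<noteq> 0);
          j = (LEAST j. coeff (coeff f i) j \<noteq> 0)
      in (int i, int j))"

text \<open>Well-defined for nonzero \<open>r\<close>, see \<open>nu_Fract\<close>.\<close>

definition nu :: "complex poly poly fract \<Rightarrow> int \<times> int" where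
  "nu r = (THE v. \<exists>f g. f \<noteq> 0 \<and> g \<noteq> 0 \<and> r = Fract f g \<and> v = low_exp f - low_exp g)"

lemma Least_coeff_mult:
  fixes p q :: "'a::idom poly"
  assumes "p \<noteq> 0" "q \<noteq> 0"
  defines "m \<equiv> (LEAST i. coeff p i \<noteq> 0)" and "n \<equiv> (LEAST i. coeff q i \<noteq> 0)"
  shows "(LEAST i. coeff (p * q) i \<noteq> 0) = m + n"
    and "coeff (p * q) (m + n) = coeff p m * coeff q n"
proof -
  have nz: "coeff p m \<noteq> 0" "coeff q n \<noteq> 0"
    unfolding m_def n_def using assms(1,2) by (auto intro!: LeastI_ex simp: poly_eq_iff)
  have lo: "coeff p i = 0" if "i < m" for i
    using that not_less_Least unfolding m_def by blast
  have lo': "coeff q i = 0" if "i < n" for i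
    using that not_less_Least unfolding n_def by blast
  have "coeff (p * q) (m + n) = (\<Sum>i\<le>m + n. coeff p i * coeff q (m + n - i))"
    by (simp add: coeff_mult)
  also have "\<dots> = (\<Sum>i\<in>{m}. coeff p i * coeff q (m + n - i))"
  proof (rule sum.mono_neutral_right)
    show "\<forall>i\<in>{..m + n} - {m}. coeff p i * coeff q (m + n - i) = 0"
    proof
      fix i assume "i \<in> {..m + n} - {m}"
      then have "i < m \<or> m + n - i < n" by auto
      then show "coeff p i * coeff q (m + n - i) = 0" using lo lo' by auto
    qed
  qed auto
  finally show eq: "coeff (p * q) (m + n) = coeff p m * coeff q n" by simp
  show "(LEAST i. coeff (p * q) i \<noteq> 0) = m + n"
  proof (rule Least_equality)
    show "coeff (p * q) (m + n) \<noteq> 0" using eq nz by simp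
    fix k assume k: "coeff (p * q) k \<noteq> 0"
    show "m + n \<le> k"
    proof (rule ccontr)
      assume "\<not> m + n \<le> k"
      then have "coeff p i * coeff q (k - i) = 0" if "i \<le> k" for i
        using lo[of i] lo'[of "k - i"] that by (cases "i < m") auto
      then have "coeff (p * q) k = 0" unfolding coeff_mult by (intro sum.neutral) auto
      with k show False by simp
    qed
  qed
qed

lemma low_exp_alt:
  "low_exp f = (int (LEAST i. coeff f i \<noteq> 0),
     int (LEAST j. coeff (coeff f (LEAST i. coeff f i \<noteq> 0)) j \<noteq> 0))"
  unfolding low_exp_def Let_def by (simp add: poly_eq_iff)

lemma low_exp_mult:
  assumes "f \<noteq> 0" "g \<noteq> 0"
  shows "low_exp (f * g) = low_exp f + low_exp g"
proof -
  define m n where "m = (LEAST i. coeff f i \<noteq> 0)" and "n = (LEAST i. coeff g i \<noteq> 0)"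
  have nz: "coeff f m \<noteq> 0" "coeff g n \<noteq> 0"
    unfolding m_def n_def using assms by (auto intro!: LeastI_ex simp: poly_eq_iff)
  show ?thesis
    unfolding low_exp_alt Least_coeff_mult[OF assms]
    unfolding m_def[symmetric] n_def[symmetric]
    using Least_coeff_mult(1)[OF nz] by simp
qed

lemma nu_Fract:
  assumes "f \<noteq> 0" "g \<noteq> 0"
  shows "nu (Fract f g) = low_exp f - low_exp g"
  unfolding nu_def
proof (rule the_equality)
  show "\<exists>f' g'. f' \<noteq> 0 \<and> g' \<noteq> 0 \<and> Fract f g = Fract f' g' \<and>
      low_exp f - low_exp g = low_exp f' - low_exp g'"
    using assms by blast
  fix v assume "\<exists>f' g'. f' \<noteq> 0 \<and> g' \<noteq> 0 \<and> Fract f g = Fract f' g' \<and> v = low_exp f' - low_exp g'"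
  then obtain f' g' where *: "f' \<noteq> 0" "g' \<noteq> 0" "f * g' = f' * g" "v = low_exp f' - low_exp g'"
    using assms by (auto simp: eq_fract)
  then have "low_exp f + low_exp g' = low_exp f' + low_exp g"
    using assms by (metis low_exp_mult)
  then show "v = low_exp f - low_exp g" using *(4) by (auto simp: prod_eq_iff)
qed


section \<open>The Newton--Okounkov body\<close>

text \<open>
  A nowhere vanishing section of \<open>L\<^sub>\<lambda>\<close> over \<open>Pet3_open\<close>, which is an affine plane via \<open>chart\<close>. Since
  \<open>chart\<close> lifts this isomorphism to \<open>GL3\<close>, a section is regular iff its pullback along
  \<open>chart\<close> is a polynomial in \<open>x\<close> and \<open>y\<close>.
\<close>

definition nowhere_vanishing_section :: "nat^3 \<Rightarrow> (complex^3^3 \<Rightarrow> complex) \<Rightarrow> bool" where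
  "nowhere_vanishing_section lam \<tau> \<longleftrightarrow>
     equivariant_on Pet3_open lam \<tau> \<and>
     (\<exists>t. \<forall>x y. \<tau> (chart x y) = eval_xy t x y) \<and>
     (\<forall>M\<in>\<Union>Pet3_open. \<tau> M \<noteq> 0)"

text \<open>
  \<open>f\<close> is the polynomial \<open>\<sigma> / \<tau>\<^sup>k\<close>; by equivariance the quotient is constant on cosets, so its value
  at a flag may be computed at the representative \<open>chart x y\<close>.
\<close>

definition is_quotient ::
    "complex poly poly \<Rightarrow> (complex^3^3 \<Rightarrow> complex) \<Rightarrow> (complex^3^3 \<Rightarrow> complex) \<Rightarrow> nat \<Rightarrow> bool" where
  "is_quotient f \<sigma> \<tau> k \<longleftrightarrow> (\<forall>x y. eval_xy f x y = \<sigma> (chart x y) / \<tau> (chart x y) ^ k)"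

definition real_pair :: "int \<times> int \<Rightarrow> real \<times> real" where
  "real_pair v = (real_of_int (fst v), real_of_int (snd v))"

definition NO_body ::
    "(nat \<Rightarrow> (complex^3^3 \<Rightarrow> complex) set) \<Rightarrow> (complex^3^3 \<Rightarrow> complex) \<Rightarrow> (real \<times> real) set" where
  "NO_body R \<tau> = closure (convex hull
     (\<Union>k\<in>{1..}. {(1 / real k) *\<^sub>R real_pair (nu (Fract f 1)) | f \<sigma>.
        \<sigma> \<in> R k \<and> \<sigma> \<noteq> 0 \<and> is_quotient f \<sigma> \<tau> k}))"

definition lam_weight :: "nat \<Rightarrow> nat \<Rightarrow> nat^3" where
  "lam_weight a1 a2 = vector [a1 + a2, a1, 0]"

lemma nowhere_vanishing_section_exists:
  "\<exists>\<tau>. nowhere_vanishing_section (lam_weight a1 a2) \<tau>"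
proof
  let ?m = "\<lambda>M::complex^3^3. M $ 2 $ 1 * M $ 3 $ 2 - M $ 3 $ 1 * M $ 2 $ 2"
  let ?t = "\<lambda>M::complex^3^3. (M $ 3 $ 1) ^ a2 * ?m M ^ a1"
  have tr: "?t (M ** b) = weight_char (lam_weight a1 a2) b * ?t M" if "b \<in> Borel3" for M b
  proof -
    have b: "b $ 2 $ 1 = 0" "b $ 3 $ 1 = 0" "b $ 3 $ 2 = 0"
      using that by (auto simp: Borel3_def)
    have 1: "(M ** b) $ 3 $ 1 = b $ 1 $ 1 * M $ 3 $ 1"
      by (simp add: matrix_matrix_mult_def sum_3 b)
    have 2: "?m (M ** b) = (b $ 1 $ 1 * b $ 2 $ 2) * ?m M"
      by (simp add: matrix_matrix_mult_def sum_3 b algebra_simps)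
    have 3: "weight_char (lam_weight a1 a2) b = b $ 1 $ 1 ^ (a1 + a2) * b $ 2 $ 2 ^ a1"
      unfolding weight_char_def UNIV_3 by (simp add: lam_weight_def)
    show ?thesis
      unfolding 2 unfolding 1 3 power_mult_distrib power_add by (simp only: mult_ac)
  qed
  have ch: "?t (chart x y) = (- 1) ^ a1" for x y
    by (simp add: chart_def)
  have nz: "?t M \<noteq> 0" if M: "M \<in> \<Union>Pet3_open" for M
  proof -
    from M obtain x y b where b: "b \<in> Borel3" and M: "M = chart x y ** b"
      by (auto simp: Pet3_open_def flag_of_def)
    have "invertible b" and "b $ 2 $ 1 = 0" "b $ 3 $ 1 = 0" "b $ 3 $ 2 = 0"
      using b by (auto simp: Borel3_def GL3_def)
    then have "b $ i $ i \<noteq> 0" for i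
      using exhaust_3[of i] by (auto simp: invertible_det_nz det_3)
    then have "weight_char (lam_weight a1 a2) b \<noteq> 0" by (simp add: weight_char_def)
    then show ?thesis unfolding M tr[OF b] ch by simp
  qed
  have "(- 1) ^ a1 = eval_xy [:[:(- 1) ^ a1:]:] x y" for x y by (simp add: eval_xy_def)
  then show "nowhere_vanishing_section (lam_weight a1 a2) ?t"
    unfolding nowhere_vanishing_section_def equivariant_on_def ch using tr nz by blast
qed

end

theory Submission
  imports Defs "HOL-Computational_Algebra.Fundamental_Theorem_Algebra"
begin

text \<open>
  On the chart the Pluecker coordinates are \<open>y, x, 1\<close> and \<open>y - x\<^sup>2, -x, -1\<close>. Products of these with
  \<open>x\<^sup>3 = x y - x (y - x\<^sup>2)\<close> already realise the vertices at level \<open>k = 1\<close>.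

  For the converse, a section of level \<open>k\<close> is followed along two families of curves in the Peterson
  variety that leave the chart. Its quotient \<open>f\<close> then satisfies \<open>deg f (x, y) \<le> K = k (2 a\<^sub>1 + a\<^sub>2)\<close>
  and \<open>deg f (x, y + x\<^sup>2) \<le> L = k (a\<^sub>1 + 2 a\<^sub>2)\<close>. Give \<open>x\<close> weight 1 and \<open>y\<close> weight 2, and write
  the weight-\<open>d\<close> part of \<open>f\<close> as \<open>x\<^sup>d \<phi> (y / x\<^sup>2)\<close>. The two degree bounds say that \<open>t\<^sup>d\<^sup>-\<^sup>K\<close> and
  \<open>(t - 1)\<^sup>d\<^sup>-\<^sup>L\<close> divide \<open>\<phi>\<close>. If \<open>x\<^sup>\<alpha> y\<^sup>\<beta>\<close> is the lowest term of \<open>f\<close> and \<open>d = \<alpha> + 2 \<beta>\<close>, then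
  \<open>\<beta>\<close> is the degree of \<open>\<phi>\<close>, so \<open>max 0 (d - K) + max 0 (d - L) \<le> \<beta>\<close>. These inequalities
  cut out \<open>k\<close> times the quadrilateral.
\<close>

section \<open>Weight parts and lowest terms of polynomials\<close>

lemma eval_xy_add: "eval_xy (f + g) x y = eval_xy f x y + eval_xy g x y"
  and eval_xy_mult: "eval_xy (f * g) x y = eval_xy f x y * eval_xy g x y"
  and eval_xy_power: "eval_xy (f ^ n) x y = eval_xy f x y ^ n"
  and eval_xy_const: "eval_xy [:[:c:]:] x y = c"
  by (simp_all add: eval_xy_def poly_power)

lemma eval_xy_sum:
  "eval_xy f x y = (\<Sum>i\<le>degree f. poly (coeff f i) y * x ^ i)"
  by (simp add: eval_xy_def poly_altdef[of f] poly_sum poly_power)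

text \<open>Over the domain \<open>complex poly\<close> every constant \<open>[:x:]\<close> is a
  root of \<open>f - g\<close>, while a nonzero polynomial has only finitely many roots.\<close>

lemma eval_xy_eqI:
  assumes "\<And>x y. eval_xy f x y = eval_xy g x y"
  shows "f = g"
proof -
  have "poly f [:x:] = poly g [:x:]" for x
    using assms by (intro poly_ext) (simp add: eval_xy_def)
  then have "range (\<lambda>x. [:x:]) \<subseteq> {p. poly (f - g) p = 0}"
    by auto
  moreover have "infinite (range (\<lambda>x::complex. [:x:]))"
    by (subst finite_image_iff) (auto simp: inj_on_def infinite_UNIV_char_0)
  ultimately have "infinite {p. poly (f - g) p = 0}"
    using finite_subset by blast
  then show ?thesis
    using poly_roots_finite[of "f - g"] by auto
qed

text \<open>The fundamental theorem of algebra applies in \<open>y\<close> for fixed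
  \<open>x\<close>, then in \<open>x\<close> along \<open>y = 0\<close>. This will make
  \<open>\<tau>\<close> constant on the chart.\<close>

lemma eval_xy_nonvanishing_const:
  assumes "\<And>x y. eval_xy t x y \<noteq> 0"
  obtains c where "c \<noteq> 0" "\<And>x y. eval_xy t x y = c"
proof -
  have const: "p = [:poly p 0:]" if "\<And>z. poly p z \<noteq> 0" for p :: "complex poly"
    using that fundamental_theorem_of_algebra[of p]
    by (metis constant_degree degree_eq_zeroE poly_pCons mult_zero_left add.right_neutral poly_0)
  have 1: "eval_xy t x y = eval_xy t x 0" for x y
    using const[of "poly t [:x:]"] assms[of x] unfolding eval_xy_def
    by (metis poly_pCons mult_zero_right add.right_neutral poly_0)
  define q where "q = map_poly (\<lambda>p. poly p 0) t"
  have q: "poly q x = eval_xy t x 0" for x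
    unfolding q_def eval_xy_def by (induction t) (simp_all add: map_poly_pCons)
  have 2: "eval_xy t x 0 = eval_xy t 0 0" for x
    using const[of q] assms unfolding q
    by (metis q poly_pCons mult_zero_right add.right_neutral poly_0)
  show thesis
    using that[of "eval_xy t 0 0"] assms 1 2 by metis
qed

text \<open>
  The coefficient of \<open>s\<^sup>d\<close> in \<open>f (s, s\<^sup>2 t)\<close>, that is, the part of \<open>f\<close> of weight \<open>d\<close>
  for the grading with \<open>x\<close> of weight 1 and \<open>y\<close> of weight 2.
\<close>

definition weight_part :: "complex poly poly \<Rightarrow> nat \<Rightarrow> complex poly" where
  "weight_part f d = (\<Sum>b\<le>d div 2. monom (coeff (coeff f (d - 2 * b)) b) b)"

lemma coeff_weight_part:
  "coeff (weight_part f d) b = (if 2 * b \<le> d then coeff (coeff f (d - 2 * b)) b else 0)"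
proof -
  have "coeff (weight_part f d) b =
      (\<Sum>j\<le>d div 2. if j = b then coeff (coeff f (d - 2 * b)) b else 0)"
    unfolding weight_part_def coeff_sum coeff_monom by (intro sum.cong) auto
  also have "\<dots> = (if b \<le> d div 2 then coeff (coeff f (d - 2 * b)) b else 0)"
    by (simp add: sum.delta')
  finally show ?thesis by auto
qed

lemma poly_eq_sum_le:
  fixes p :: "complex poly"
  assumes "degree p \<le> n"
  shows "poly p x = (\<Sum>i\<le>n. coeff p i * x ^ i)"
  unfolding poly_altdef using assms
  by (intro sum.mono_neutral_left) (auto simp: coeff_eq_0)

text \<open>At \<open>(s, s\<^sup>2 * t)\<close> the monomial \<open>x^i y^j\<close> becomes
  \<open>s^(i + 2 j) t^j\<close>. Every cutoff beyond \<open>N\<close> is allowed, so any prescribed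
  weight can be brought into range.\<close>

lemma eval_xy_weight_parts:
  obtains N where "\<And>n s t. N \<le> n \<Longrightarrow>
    eval_xy f s (s\<^sup>2 * t) = (\<Sum>d\<le>n. s ^ d * poly (weight_part f d) t)"
proof
  define B where "B = (\<Sum>i\<le>degree f. degree (coeff f i))"
  have B: "degree (coeff f i) \<le> B" for i
  proof (cases "i \<le> degree f")
    case True then show ?thesis unfolding B_def by (intro member_le_sum) auto
  qed (simp add: coeff_eq_0)
  let ?c = "\<lambda>i j. coeff (coeff f i) j"
  have c0: "i \<le> degree f \<and> j \<le> B" if "?c i j \<noteq> 0" for i j
    using that le_degree[of f i] le_degree[of "coeff f i" j] B[of i] by force
  fix n s t assume n: "degree f + 2 * B \<le> n"
  have "eval_xy f s (s\<^sup>2 * t) = (\<Sum>i\<le>degree f. \<Sum>j\<le>B. ?c i j * (s\<^sup>2 * t) ^ j * s ^ i)"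
    unfolding eval_xy_sum poly_eq_sum_le[OF B] by (simp add: sum_distrib_right)
  also have "\<dots> = (\<Sum>(i,j)\<in>{..degree f} \<times> {..B}. ?c i j * (s\<^sup>2 * t) ^ j * s ^ i)"
    by (simp add: sum.cartesian_product)
  also have "\<dots> = (\<Sum>(d,b)\<in>(SIGMA d:{..n}. {..d div 2}). s ^ d * (?c (d - 2 * b) b * t ^ b))"
  \<comment> \<open>The correspondence is \<open>d = i + 2 * j\<close>, \<open>b = j\<close>. Zero
    terms are discarded on both sides, because the index ranges match only on the support of
    \<open>f\<close>.\<close>
  proof (rule sum.reindex_bij_witness_not_neutral[where
        S' = "{(i,j)\<in>{..degree f} \<times> {..B}. ?c i j = 0}" and T' = "{(d,b)\<in>(SIGMA d:{..n}. {..d div 2}). ?c (d - 2 * b) b = 0}"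
        and i = "\<lambda>(d,b). (d - 2 * b, b)" and j = "\<lambda>(i,j). (i + 2 * j, j)"], goal_cases)
    case 1 show ?case by (rule finite_subset[of _ "{..degree f} \<times> {..B}"]) auto
  next
    case 2 show ?case by (rule finite_subset[of _ "SIGMA d:{..n}. {..d div 2}"]) auto
  next
    case (4 a)
    then show ?case using n by auto
  next
    case (6 b)
    then show ?case using c0 by (auto split: prod.splits)
  next
    case (9 a)
    then show ?case by (auto simp: power_add power_mult power_mult_distrib)
  qed auto
  also have "\<dots> = (\<Sum>d\<le>n. s ^ d * poly (weight_part f d) t)"
    by (simp add: sum.Sigma[symmetric] weight_part_def poly_sum poly_monom sum_distrib_left)
  finally show "eval_xy f s (s\<^sup>2 * t) = (\<Sum>d\<le>n. s ^ d * poly (weight_part f d) t)" .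
qed

text \<open>Put \<open>s = 1 / u\<close> and \<open>t = e + w\<close> and compare coefficients of
  \<open>u^(K - d)\<close>. On the left stands \<open>weight_part f d\<close> at
  \<open>e + w\<close>, on the right the terms \<open>(w / u)^b u^j\<close> with
  \<open>j = K + b - d\<close>. As \<open>j\<close> is not negative, only exponents \<open>b\<close>
  of \<open>w\<close> with \<open>b \<ge> d - K\<close> occur.\<close>

lemma weight_part_dvd:
  assumes H: "\<And>u w. u \<noteq> 0 \<Longrightarrow> u ^ K * eval_xy f (1 / u) ((e + w) / u\<^sup>2) = eval_xy h (w / u) u"
  shows "[:- e, 1:] ^ (d - K) dvd weight_part f d"
proof -
  obtain N where N: "\<And>n s t. N \<le> n \<Longrightarrow>
      eval_xy f s (s\<^sup>2 * t) = (\<Sum>d\<le>n. s ^ d * poly (weight_part f d) t)"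
    using eval_xy_weight_parts[of f] by blast
  define n where "n = max N d"
  \<comment> \<open>Multiplying by \<open>u ^ L\<close> clears the poles of both sides at
    \<open>u = 0\<close>, so that coefficients of polynomials can be compared.\<close>
  define L where "L = n + degree h"
  have eq: "(\<Sum>d\<le>n. monom (poly (weight_part f d) (e + w)) (L + K - d)) =
      (\<Sum>b\<le>degree h. smult (w ^ b) (monom 1 (L - b) * coeff h b))" (is "?l = ?r") for w
  proof -
    have "poly ?l u = poly ?r u" if u: "u \<noteq> 0" for u
    proof -
      have "poly ?l u = u ^ L * (u ^ K * (\<Sum>d\<le>n. (1 / u) ^ d * poly (weight_part f d) (e + w)))"
        using u by (auto simp: poly_sum poly_monom sum_distrib_left L_def power_add
            power_diff field_simps intro!: sum.cong)
      also have "(\<Sum>d\<le>n. (1 / u) ^ d * poly (weight_part f d) (e + w)) =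
          eval_xy f (1 / u) ((e + w) / u\<^sup>2)"
        using N[of n "1 / u" "e + w"] by (simp add: n_def power_one_over field_simps)
      also have "u ^ K * \<dots> = eval_xy h (w / u) u" by (rule H[OF u])
      also have "u ^ L * \<dots> = poly ?r u"
        using u by (auto simp: eval_xy_sum poly_sum poly_monom sum_distrib_left L_def power_add
            power_diff power_divide field_simps intro!: sum.cong)
      finally show ?thesis .
    qed
    then have "UNIV - {0} \<subseteq> {u. poly (?l - ?r) u = 0}" by auto
    moreover have "infinite (UNIV - {0::complex})"
      by (simp add: infinite_UNIV_char_0)
    ultimately have "infinite {u. poly (?l - ?r) u = 0}" using finite_subset by blast
    then show ?thesis using poly_roots_finite[of "?l - ?r"] by auto
  qed
  \<comment> \<open>The coefficient of \<open>w^b u^(K - d)\<close> in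
    \<open>eval_xy h (w / u) u\<close>; the guard excludes the truncated case of
    \<open>K + b - d\<close>.\<close>
  define c where "c b = (if K + b < d then 0 else coeff (coeff h b) (K + b - d))" for b
  have wp: "poly (weight_part f d) (e + w) = (\<Sum>b\<le>degree h. c b * w ^ b)" for w
  proof -
    have "poly (weight_part f d) (e + w) =
        (\<Sum>d'\<le>n. if d' = d then poly (weight_part f d) (e + w) else 0)"
      by (simp add: n_def)
    also have "\<dots> = coeff (\<Sum>d\<le>n. monom (poly (weight_part f d) (e + w)) (L + K - d)) (L + K - d)"
      unfolding coeff_sum coeff_monom by (intro sum.cong) (auto simp: L_def n_def)
    also have "\<dots> = (\<Sum>b\<le>degree h. c b * w ^ b)"
      unfolding eq coeff_sum
    proof (intro sum.cong refl)
      fix b assume b: "b \<in> {..degree h}"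
      have *: "L + K - d < L - b \<longleftrightarrow> K + b < d" "L + K - d - (L - b) = K + b - d"
        using b by (auto simp: L_def n_def)
      then show "coeff (smult (w ^ b) (monom 1 (L - b) * coeff h b)) (L + K - d) = c b * w ^ b"
        unfolding coeff_smult coeff_monom_mult c_def * by simp
    qed
    finally show ?thesis .
  qed
  define q where "q = (\<Sum>b\<le>degree h. smult (c b) ([:- e, 1:] ^ b))"
  have "poly (weight_part f d) t = poly q t" for t
    using wp[of "t - e"] by (simp add: q_def poly_sum poly_power)
  then have "weight_part f d = q" by (intro poly_ext)
  moreover have "[:- e, 1:] ^ (d - K) dvd q"
    unfolding q_def
  proof (rule dvd_sum)
    fix b show "[:- e, 1:] ^ (d - K) dvd smult (c b) ([:- e, 1:] ^ b)"
      by (cases "d - K \<le> b") (auto simp: c_def intro!: dvd_smult le_imp_power_dvd)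
  qed
  ultimately show ?thesis by simp
qed

text \<open>
  Within one weight, small \<open>x\<close>-exponents mean large \<open>y\<close>-exponents, so the \<open>y\<close>-exponent of the lowest
  term is the degree of the weight part in \<open>t\<close>. The two powers are coprime divisors of it.
\<close>

lemma low_exp_bound:
  assumes f: "f \<noteq> 0" and le: "low_exp f = (int \<alpha>, int \<beta>)"
    and 0: "[:0, 1:] ^ (\<alpha> + 2 * \<beta> - K) dvd weight_part f (\<alpha> + 2 * \<beta>)"
    and 1: "[:-1, 1:] ^ (\<alpha> + 2 * \<beta> - L) dvd weight_part f (\<alpha> + 2 * \<beta>)"
  shows "(\<alpha> + 2 * \<beta> - K) + (\<alpha> + 2 * \<beta> - L) \<le> \<beta>"
proof -
  let ?p = "weight_part f (\<alpha> + 2 * \<beta>)"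
  have \<alpha>: "\<alpha> = (LEAST i. coeff f i \<noteq> 0)" and \<beta>: "\<beta> = (LEAST j. coeff (coeff f \<alpha>) j \<noteq> 0)"
    using le by (auto simp: low_exp_alt)
  have "coeff f \<alpha> \<noteq> 0"
    unfolding \<alpha> using f by (auto intro!: LeastI_ex simp: poly_eq_iff)
  then have nz: "coeff (coeff f \<alpha>) \<beta> \<noteq> 0"
    unfolding \<beta> by (auto intro!: LeastI_ex simp: poly_eq_iff)
  have lo: "coeff f i = 0" if "i < \<alpha>" for i
    using that not_less_Least unfolding \<alpha> by blast
  have p: "?p \<noteq> 0"
    using nz coeff_weight_part[of f "\<alpha> + 2 * \<beta>" \<beta>] by auto
  have deg: "degree ?p \<le> \<beta>"
  proof (rule degree_le, safe)
    fix b assume "\<beta> < b"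
    then show "coeff ?p b = 0"
      by (auto simp: coeff_weight_part intro!: arg_cong[of _ 0 "\<lambda>p. coeff p b", simplified] lo)
  qed
  obtain q where q: "?p = [:0, 1:] ^ (\<alpha> + 2 * \<beta> - K) * q" using 0 by (elim dvdE)
  have "order 1 ?p = order 1 q"
    using p unfolding q by (subst order_mult) (auto simp: order_0I poly_power)
  moreover have "\<alpha> + 2 * \<beta> - L \<le> order 1 ?p" using 1 p by (auto simp: order_divides)
  moreover have "order 1 q \<le> degree q" using p q by (intro order_degree) auto
  moreover have "degree ?p = (\<alpha> + 2 * \<beta> - K) + degree q"
    using p unfolding q by (subst degree_mult_eq) (auto simp: degree_power_eq)
  ultimately show ?thesis using deg by linarith
qed

section \<open>Flags and the Peterson variety\<close>

lemma matrix_inv_mult: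
  fixes A :: "complex^3^3"
  assumes "invertible A"
  shows "A ** matrix_inv A = mat 1" "matrix_inv A ** A = mat 1"
  using someI_ex[OF assms[unfolded invertible_def]] unfolding matrix_inv_def by blast+

lemma Borel3_iff:
  "b \<in> Borel3 \<longleftrightarrow> b $ 2 $ 1 = 0 \<and> b $ 3 $ 1 = 0 \<and> b $ 3 $ 2 = 0 \<and> det b \<noteq> 0"
  by (auto simp: Borel3_def GL3_def invertible_det_nz)

lemma GL3_iff: "M \<in> GL3 \<longleftrightarrow> det M \<noteq> 0"
  by (simp add: GL3_def invertible_det_nz)

lemma mat_1_Borel3: "mat 1 \<in> Borel3"
  by (simp add: Borel3_iff) (simp add: mat_def)

lemma Borel3_mult:
  assumes "b \<in> Borel3" "c \<in> Borel3"
  shows "b ** c \<in> Borel3"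
  using assms unfolding Borel3_iff det_mul by (simp add: matrix_matrix_mult_def sum_3)

lemma weight_char_lam_weight:
  "weight_char (lam_weight a1 a2) b = b $ 1 $ 1 ^ (a1 + a2) * b $ 2 $ 2 ^ a1"
  unfolding weight_char_def UNIV_3 by (simp add: lam_weight_def)

lemma mem_flag_of: "M \<in> flag_of M"
  unfolding flag_of_def using mat_1_Borel3 by (auto intro!: image_eqI[of _ _ "mat 1"])

lemma det_chart: "det (chart x y) = -1"
  by (simp add: chart_def det_3)

lemma Union_Flags3: "\<Union>Flags3 = GL3"
  using mem_flag_of
  by (fastforce simp: Flags3_def flag_of_def GL3_iff Borel3_iff det_mul)

lemma Pet3_subset_GL3: "\<Union>Pet3 \<subseteq> GL3"
  by (fastforce simp: Pet3_def flag_of_def GL3_iff Borel3_iff det_mul)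

lemma Union_Pet3_mult:
  assumes "M \<in> \<Union>Pet3" "b \<in> Borel3"
  shows "M ** b \<in> \<Union>Pet3"
  using assms unfolding Pet3_def flag_of_def
  by (fastforce simp: matrix_mul_assoc[symmetric] intro: Borel3_mult)

lemma Union_Pet3_open_mult:
  assumes "M \<in> \<Union>Pet3_open" "b \<in> Borel3"
  shows "M ** b \<in> \<Union>Pet3_open"
  using assms unfolding Pet3_open_def flag_of_def
  by (fastforce simp: matrix_mul_assoc[symmetric] intro: Borel3_mult)

lemma flag_chart_in_Pet3: "flag_of (chart x y) \<in> Pet3"
proof -
  let ?X = "vector [vector [0, 0, 0], vector [1, 0, 0], vector [0, 1, 0]] :: complex^3^3"
  have GL: "chart x y \<in> GL3" by (simp add: GL3_iff det_chart)
  have "nilp3 ** chart x y = chart x y ** ?X"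
    by (simp add: vec_eq_iff forall_3 matrix_matrix_mult_def sum_3 nilp3_def chart_def)
  then have "matrix_inv (chart x y) ** nilp3 ** chart x y =
      matrix_inv (chart x y) ** chart x y ** ?X"
    by (simp add: matrix_mul_assoc[symmetric])
  also have "\<dots> = ?X"
    using GL by (simp add: GL3_def matrix_inv_mult)
  finally show ?thesis using GL by (auto simp: Pet3_def)
qed

lemma Pet3_open_subset: "\<Union>Pet3_open \<subseteq> \<Union>Pet3"
  using flag_chart_in_Pet3 by (auto simp: Pet3_open_def)

lemma chart_in_Pet3: "chart x y \<in> \<Union>Pet3"
  using flag_chart_in_Pet3 mem_flag_of by blast

text \<open>The rows of \<open>?b\<close> are those of the inverse of \<open>chart x y\<close> times
  \<open>M\<close>. The three equations make its entries below the diagonal vanish; the two diagonal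
  entries determine the weight character.\<close>

lemma chart_factorization:
  assumes M: "M \<in> GL3" "M $ 3 $ 1 \<noteq> 0"
    and x: "M $ 2 $ 1 = x * M $ 3 $ 1" and y: "M $ 1 $ 1 = y * M $ 3 $ 1"
    and "M $ 1 $ 2 - x * M $ 2 $ 2 + (x\<^sup>2 - y) * M $ 3 $ 2 = 0"
  obtains b where "b \<in> Borel3" "M = chart x y ** b"
    "b $ 1 $ 1 = M $ 3 $ 1" "b $ 2 $ 2 = M $ 2 $ 2 - x * M $ 3 $ 2"
proof
  let ?r1 = "\<lambda>j. M $ 3 $ j" and ?r2 = "\<lambda>j. M $ 2 $ j - x * M $ 3 $ j"
    and ?r3 = "\<lambda>j. M $ 1 $ j - x * M $ 2 $ j + (x\<^sup>2 - y) * M $ 3 $ j"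
  let ?b = "vector [vector [?r1 1, ?r1 2, ?r1 3], vector [?r2 1, ?r2 2, ?r2 3],
    vector [?r3 1, ?r3 2, ?r3 3]] :: complex^3^3"
  show eq: "M = chart x y ** ?b"
    by (simp add: vec_eq_iff forall_3 matrix_matrix_mult_def sum_3 chart_def algebra_simps
        power2_eq_square)
  have "det M = det (chart x y) * det ?b" by (subst eq) (rule det_mul)
  then have "det ?b \<noteq> 0" using M(1) by (auto simp: GL3_iff)
  then show "?b \<in> Borel3" using assms
    by (simp add: Borel3_iff algebra_simps power2_eq_square)
qed auto

text \<open>The hypotheses say that \<open>N V\<^sub>1 \<subseteq> V\<^sub>2\<close> and that \<open>V\<^sub>1\<close> is not in the plane \<open>v\<^sub>3 = 0\<close>.\<close>

lemma mem_Pet3_open: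
  assumes M: "M \<in> GL3" "M $ 3 $ 1 \<noteq> 0"
    and eqs: "M $ 2 $ 1 = M $ 1 $ 1 * \<alpha> + M $ 1 $ 2 * \<beta>"
      "M $ 3 $ 1 = M $ 2 $ 1 * \<alpha> + M $ 2 $ 2 * \<beta>"
      "0 = M $ 3 $ 1 * \<alpha> + M $ 3 $ 2 * \<beta>"
  shows "M \<in> \<Union>Pet3_open"
proof -
  define x y where "x = M $ 2 $ 1 / M $ 3 $ 1" and "y = M $ 1 $ 1 / M $ 3 $ 1"
  have xy: "M $ 2 $ 1 = x * M $ 3 $ 1" "M $ 1 $ 1 = y * M $ 3 $ 1"
    using M by (auto simp: x_def y_def)
  \<comment> \<open>Otherwise the third equation gives \<open>\<alpha> = 0\<close>, and the second
    then contradicts \<open>M $ 3 $ 1 \<noteq> 0\<close>.\<close>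
  have "\<beta> \<noteq> 0" using eqs M(2) by auto
  \<comment> \<open>The row vector \<open>(1, - x, x\<^sup>2 - y)\<close> annihilates the first
    column \<open>v\<close> and \<open>N v\<close>, hence also \<open>\<beta>\<close> times the
    second column, which is \<open>N v - \<alpha> v\<close>.\<close>
  have "\<beta> * (M $ 1 $ 2 - x * M $ 2 $ 2 + (x\<^sup>2 - y) * M $ 3 $ 2) =
      (M $ 1 $ 2 * \<beta>) - x * (M $ 2 $ 2 * \<beta>) + (x\<^sup>2 - y) * (M $ 3 $ 2 * \<beta>)"
    by (simp add: algebra_simps)
  also have "\<dots> = (M $ 2 $ 1 - M $ 1 $ 1 * \<alpha>) - x * (M $ 3 $ 1 - M $ 2 $ 1 * \<alpha>)
      + (x\<^sup>2 - y) * (- M $ 3 $ 1 * \<alpha>)"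
  proof -
    have "M $ 1 $ 2 * \<beta> = M $ 2 $ 1 - M $ 1 $ 1 * \<alpha>" "M $ 2 $ 2 * \<beta> = M $ 3 $ 1 - M $ 2 $ 1 * \<alpha>"
      using eqs(1,2) by simp_all
    moreover have "M $ 3 $ 2 * \<beta> = - M $ 3 $ 1 * \<alpha>"
      using eqs(3) by (simp add: eq_neg_iff_add_eq_0 add.commute)
    ultimately show ?thesis by simp
  qed
  also have "\<dots> = 0" by (simp add: xy algebra_simps power2_eq_square)
  finally have "M $ 1 $ 2 - x * M $ 2 $ 2 + (x\<^sup>2 - y) * M $ 3 $ 2 = 0"
    using \<open>\<beta> \<noteq> 0\<close> by simp
  from chart_factorization[OF M xy this] obtain b where "b \<in> Borel3" "M = chart x y ** b"
    by metis
  then show ?thesis by (auto simp: Pet3_open_def flag_of_def)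
qed

text \<open>The witnesses are the first two entries of the first column of
  \<open>matrix_inv M ** nilp3 ** M\<close>. As the third entry is zero, they express
  \<open>N V\<^sub>1 \<subseteq> V\<^sub>2\<close>.\<close>

lemma Pet3_cond:
  assumes "M \<in> GL3" "(matrix_inv M ** nilp3 ** M) $ 3 $ 1 = 0"
  obtains \<alpha> \<beta> where "M $ 2 $ 1 = M $ 1 $ 1 * \<alpha> + M $ 1 $ 2 * \<beta>"
      "M $ 3 $ 1 = M $ 2 $ 1 * \<alpha> + M $ 2 $ 2 * \<beta>"
      "0 = M $ 3 $ 1 * \<alpha> + M $ 3 $ 2 * \<beta>"
proof
  define X where "X = matrix_inv M ** nilp3 ** M"
  have "M ** X = M ** matrix_inv M ** (nilp3 ** M)"
    by (simp add: X_def matrix_mul_assoc)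
  also have "\<dots> = nilp3 ** M" using assms(1) by (simp add: GL3_def matrix_inv_mult)
  finally have eq: "M ** X = nilp3 ** M" .
  have eq: "(nilp3 ** M) $ i $ 1 = M $ i $ 1 * X $ 1 $ 1 + M $ i $ 2 * X $ 2 $ 1" for i
    using assms(2) unfolding eq[symmetric] X_def[symmetric]
    by (simp add: matrix_matrix_mult_def sum_3)
  show "M $ 2 $ 1 = M $ 1 $ 1 * X $ 1 $ 1 + M $ 1 $ 2 * X $ 2 $ 1"
      "M $ 3 $ 1 = M $ 2 $ 1 * X $ 1 $ 1 + M $ 2 $ 2 * X $ 2 $ 1"
      "0 = M $ 3 $ 1 * X $ 1 $ 1 + M $ 3 $ 2 * X $ 2 $ 1"
    unfolding eq[symmetric] by (simp_all add: matrix_matrix_mult_def sum_3 nilp3_def)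
qed

section \<open>Regular functions on the Peterson variety\<close>

text \<open>The counterpart of \<open>regular_GL3\<close> over the preimage of \<open>X\<close>:
  restrictions of elements of the coordinate ring of \<open>GL3\<close>.\<close>

definition regular_on :: "(complex^3^3) set set \<Rightarrow> (complex^3^3 \<Rightarrow> complex) \<Rightarrow> bool" where
  "regular_on X f \<longleftrightarrow> (\<exists>p\<in>matrix_polys. \<exists>n. \<forall>M\<in>\<Union>X. f M = p M / det M ^ n)"

section \<open>Closure properties of matrix polynomials and regular functions\<close>

lemma matrix_polys_power: "p \<in> matrix_polys \<Longrightarrow> (\<lambda>M. p M ^ n) \<in> matrix_polys"
  by (induction n) (auto intro: matrix_polys.intros)

lemma matrix_polys_diff:
  assumes "p \<in> matrix_polys" "q \<in> matrix_polys"
  shows "(\<lambda>M. p M - q M) \<in> matrix_polys"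
  using matrix_polys.add[OF assms(1) matrix_polys.mult[OF matrix_polys.const[of "-1"] assms(2)]]
  by simp

lemma det_matrix_polys: "det \<in> matrix_polys"
proof -
  have "(\<lambda>M. det M) \<in> matrix_polys"
    unfolding det_3 by (intro matrix_polys.intros matrix_polys_diff)
  then show ?thesis by simp
qed

lemma regular_on_const: "regular_on X (\<lambda>M. c)"
  unfolding regular_on_def
  by (intro bexI[of _ "\<lambda>M. c"] exI[of _ 0]) (auto intro: matrix_polys.intros)

lemma regular_on_mult:
  assumes "regular_on X f" "regular_on X g"
  shows "regular_on X (\<lambda>M. f M * g M)"
proof -
  obtain p n q m where *: "p \<in> matrix_polys" "q \<in> matrix_polys"
    "\<forall>M\<in>\<Union>X. f M = p M / det M ^ n" "\<forall>M\<in>\<Union>X. g M = q M / det M ^ m"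
    using assms unfolding regular_on_def by blast
  then show ?thesis unfolding regular_on_def
    by (intro bexI[of _ "\<lambda>M. p M * q M"] exI[of _ "n + m"])
       (auto intro: matrix_polys.intros simp: power_add)
qed

lemma regular_on_add:
  assumes "regular_on X f" "regular_on X g" "\<Union>X \<subseteq> GL3"
  shows "regular_on X (\<lambda>M. f M + g M)"
proof -
  obtain p n q m where *: "p \<in> matrix_polys" "q \<in> matrix_polys"
    "\<forall>M\<in>\<Union>X. f M = p M / det M ^ n" "\<forall>M\<in>\<Union>X. g M = q M / det M ^ m"
    using assms unfolding regular_on_def by blast
  have "f M + g M = (p M * det M ^ m + q M * det M ^ n) / det M ^ (n + m)" if "M \<in> \<Union>X" for M
  proof -
    have "det M \<noteq> 0" using that assms(3) by (auto simp: GL3_iff)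
    then show ?thesis using * that by (auto simp: power_add field_simps)
  qed
  moreover have "(\<lambda>M. p M * det M ^ m + q M * det M ^ n) \<in> matrix_polys"
    using * by (intro matrix_polys.intros matrix_polys_power det_matrix_polys)
  ultimately show ?thesis unfolding regular_on_def
    by (intro bexI[of _ "\<lambda>M. p M * det M ^ m + q M * det M ^ n"] exI[of _ "n + m"]) auto
qed

lemma regular_on_prod:
  assumes "\<And>i. i < (k::nat) \<Longrightarrow> regular_on X (s i)"
  shows "regular_on X (\<lambda>M. \<Prod>i<k. s i M)"
  using assms by (induction k) (auto intro: regular_on_mult regular_on_const)

lemma regular_on_cong:
  assumes "regular_on X f" "\<And>M. M \<in> \<Union>X \<Longrightarrow> f M = g M"
  shows "regular_on X g"
  using assms unfolding regular_on_def by metis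

text \<open>Here \<open>y\<close> is the outer and \<open>u\<close> the inner variable of
  \<open>h\<close>. That \<open>h\<close> is polynomial also at \<open>u = 0\<close> is what later
  bounds pole orders.\<close>

lemma matrix_polys_along_curve:
  assumes "p \<in> matrix_polys" "\<And>i j. \<exists>h. \<forall>y u. C y u $ i $ j = eval_xy h y u"
  shows "\<exists>h. \<forall>y u. p (C y u) = eval_xy h y u"
  using assms(1)
proof induction
  case (const c)
  show ?case by (metis eval_xy_const)
next
  case (add p q)
  then show ?case by (metis eval_xy_add)
next
  case (mult p q)
  then show ?case by (metis eval_xy_mult)
qed (use assms(2) in blast)

lemma matrix_polys_continuous:
  assumes "p \<in> matrix_polys" "\<And>i j. continuous_on UNIV (\<lambda>u. C u $ i $ j)"
  shows "continuous_on UNIV (\<lambda>u. p (C u))"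
  using assms(1) by induction (auto intro!: continuous_intros assms(2))

text \<open>The factor \<open>det\<close> makes the function vanish at every nonzero
  \<open>u\<close>, even where \<open>C u\<close> is singular. Continuity extends this to
  \<open>u = 0\<close>, where the factor can be cancelled.\<close>

lemma matrix_polys_degeneration:
  fixes C :: "complex \<Rightarrow> complex^3^3"
  assumes p: "p \<in> matrix_polys" "\<And>M. M \<in> X \<Longrightarrow> p M = 0"
    and C: "\<And>i j. continuous_on UNIV (\<lambda>u. C u $ i $ j)"
    and X: "\<And>u. u \<noteq> 0 \<Longrightarrow> C u \<in> GL3 \<Longrightarrow> C u \<in> X" and "C 0 \<in> GL3"
  shows "p (C 0) = 0"
proof -
  define q where "q u = p (C u) * det (C u)" for u
  have "continuous_on UNIV q"
    unfolding q_def
    by (rule continuous_on_mult[OF matrix_polys_continuous[OF p(1) C]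
          matrix_polys_continuous[OF det_matrix_polys C]])
  then have "(q \<longlongrightarrow> q 0) (at 0)"
    by (simp add: continuous_on_def)
  moreover have "q u = 0" if "u \<noteq> 0" for u
    using X[OF that] p(2) by (auto simp: q_def GL3_iff)
  then have "(q \<longlongrightarrow> 0) (at 0)"
    by (intro tendsto_eventually) (auto simp: eventually_at_filter)
  ultimately have "q 0 = 0" using tendsto_unique[of "at (0::complex)"] by auto
  then show ?thesis using assms(5) by (simp add: q_def GL3_iff)
qed

text \<open>
  Density of the chart. The flags of \<open>Pet3\<close> outside it have \<open>V\<^sub>1\<close> in the plane \<open>v\<^sub>3 = 0\<close>; each is
  the limit at \<open>u = 0\<close> of an explicit curve of flags in \<open>Pet3\<close> with \<open>V\<^sub>1\<close> off that plane.
\<close>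

lemma vanishing_on_Pet3:
  assumes reg: "regular_on Pet3 \<sigma>"
    and eq: "\<And>M b. M \<in> \<Union>Pet3 \<Longrightarrow> b \<in> Borel3 \<Longrightarrow> \<exists>c. \<sigma> (M ** b) = c * \<sigma> M"
    and 0: "\<And>x y. \<sigma> (chart x y) = 0"
    and M: "M \<in> \<Union>Pet3"
  shows "\<sigma> M = 0"
proof -
  obtain p n where p: "p \<in> matrix_polys" "\<And>M. M \<in> \<Union>Pet3 \<Longrightarrow> \<sigma> M = p M / det M ^ n"
    using reg unfolding regular_on_def by blast
  have open0: "\<sigma> M = 0" if "M \<in> \<Union>Pet3_open" for M
    using that eq[OF chart_in_Pet3] 0 by (auto simp: Pet3_open_def flag_of_def)
  have popen0: "p M = 0" if "M \<in> \<Union>Pet3_open" for M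
  proof -
    have "M \<in> \<Union>Pet3" using that Pet3_open_subset by blast
    then show ?thesis using open0[OF that] p(2) Pet3_subset_GL3 by (auto simp: GL3_iff)
  qed
  \<comment> \<open>\<open>\<alpha>\<close> and \<open>\<beta>\<close> witness
    \<open>N V\<^sub>1 \<subseteq> V\<^sub>2\<close> along the curve; the fixed Borel factor
    \<open>b\<close> adjusts \<open>C 0\<close> to the given matrix of the same flag.\<close>
  have limit: "p (C 0 ** b) = 0"
    if cont: "\<And>i j. continuous_on UNIV (\<lambda>u. C u $ i $ j)" and 0: "C 0 ** b \<in> GL3" "b \<in> Borel3"
      and C: "\<And>u. u \<noteq> 0 \<Longrightarrow> C u $ 3 $ 1 \<noteq> 0 \<and>
      C u $ 2 $ 1 = C u $ 1 $ 1 * \<alpha> u + C u $ 1 $ 2 * \<beta> u \<and>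
      C u $ 3 $ 1 = C u $ 2 $ 1 * \<alpha> u + C u $ 2 $ 2 * \<beta> u \<and>
      0 = C u $ 3 $ 1 * \<alpha> u + C u $ 3 $ 2 * \<beta> u"
    for C :: "complex \<Rightarrow> complex^3^3" and b \<alpha> \<beta>
  proof (rule matrix_polys_degeneration[where C = "\<lambda>u. C u ** b", OF p(1) popen0 _ _ 0(1)])
    show "continuous_on UNIV (\<lambda>u. (C u ** b) $ i $ j)" for i j
      by (simp add: matrix_matrix_mult_def sum_3) (intro continuous_intros cont)
    show "C u ** b \<in> \<Union>Pet3_open" if "u \<noteq> 0" "C u ** b \<in> GL3" for u
    proof -
      have "C u \<in> GL3" using that by (auto simp: GL3_iff det_mul)
      then show ?thesis using C[OF that(1)] 0(2) by (intro Union_Pet3_open_mult mem_Pet3_open) auto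
    qed
  qed
  have *: "\<sigma> M = 0" if M: "M \<in> GL3" "(matrix_inv M ** nilp3 ** M) $ 3 $ 1 = 0" for M
  proof -
    have MP: "M \<in> \<Union>Pet3" using M mem_flag_of by (auto simp: Pet3_def)
    obtain \<alpha> \<beta> where e: "M $ 2 $ 1 = M $ 1 $ 1 * \<alpha> + M $ 1 $ 2 * \<beta>"
      "M $ 3 $ 1 = M $ 2 $ 1 * \<alpha> + M $ 2 $ 2 * \<beta>"
      "0 = M $ 3 $ 1 * \<alpha> + M $ 3 $ 2 * \<beta>"
      using Pet3_cond[OF M] by blast
    show ?thesis
    proof (cases "M $ 3 $ 1 = 0")
      case False
      then show ?thesis using mem_Pet3_open[OF M(1) _ e] open0 by blast
    next
      case M31: True
      have "p M = 0"
      proof (cases "M $ 2 $ 1 = 0")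
        case M21: False
        then have M32: "M $ 3 $ 2 = 0" using e M31 by auto
        define y where "y = M $ 1 $ 1 / M $ 2 $ 1"
        \<comment> \<open>\<open>V\<^sub>1\<close> tends to the span of \<open>(y, 1, 0)\<close>;
          the second column is \<open>nilp3\<close> times the first.\<close>
        define C where "C u = (vector [vector [y, 1, 0], vector [1, u, 0], vector [u, 0, 1]] :: complex^3^3)" for u
        define b where "b = (vector [M $ 2,
          vector [M $ 1 $ 1 - y * M $ 2 $ 1, M $ 1 $ 2 - y * M $ 2 $ 2, M $ 1 $ 3 - y * M $ 2 $ 3],
          M $ 3] :: complex^3^3)"
        have eq: "M = C 0 ** b"
          by (simp add: vec_eq_iff forall_3 matrix_matrix_mult_def sum_3 C_def b_def)
        have "det M = det (C 0) * det b" by (subst eq) (rule det_mul)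
        then have b: "b \<in> Borel3" using M(1) M21 M31 M32
          by (auto simp: Borel3_iff GL3_iff b_def y_def)
        have "p (C 0 ** b) = 0"
        proof (rule limit[where \<alpha> = "\<lambda>u. 0" and \<beta> = "\<lambda>u. 1"])
          show "continuous_on UNIV (\<lambda>u. C u $ i $ j)" for i j
            using exhaust_3[of i] exhaust_3[of j] by (auto simp: C_def)
        qed (use M(1) eq b in \<open>auto simp: C_def\<close>)
        then show ?thesis using eq by simp
      next
        case M21: True
        show ?thesis
        proof (cases "M $ 3 $ 2 = 0")
          case True
          \<comment> \<open>The limit is the standard flag; \<open>nilp3\<close> sends the first
            column \<open>(1, 0, u)\<close> to \<open>u\<close> times the second.\<close>
          define C where "C u = (vector [vector [1, 0, 0], vector [0, 1, 0], vector [u, 0, 1]] :: complex^3^3)" for u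
          have eq: "M = C 0 ** M"
            by (simp add: vec_eq_iff forall_3 matrix_matrix_mult_def sum_3 C_def)
          have "p (C 0 ** M) = 0"
          proof (rule limit[where \<alpha> = "\<lambda>u. 0" and \<beta> = "\<lambda>u. u"])
            show "continuous_on UNIV (\<lambda>u. C u $ i $ j)" for i j
              using exhaust_3[of i] exhaust_3[of j] by (auto simp: C_def)
          qed (use M(1) eq True M21 M31 in \<open>auto simp: C_def Borel3_iff GL3_iff\<close>)
          then show ?thesis using eq by simp
        next
          case M32: False
          define a where "a = M $ 2 $ 2 / M $ 3 $ 2"
          \<comment> \<open>\<open>V\<^sub>1\<close> tends to the first axis while
            \<open>V\<^sub>2\<close> keeps containing \<open>(0, a, 1)\<close>. The first column
            \<open>v\<close> satisfies \<open>N v = u v - u^3 (0, a, 1)\<close>.\<close>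
          define C where "C u = (vector [vector [1 + a * u, 0, 0],
            vector [u + a * u\<^sup>2, a, 1], vector [u\<^sup>2, 1, 0]] :: complex^3^3)" for u
          define b where "b = (vector [M $ 1, M $ 3, vector [M $ 2 $ 1 - a * M $ 3 $ 1,
            M $ 2 $ 2 - a * M $ 3 $ 2, M $ 2 $ 3 - a * M $ 3 $ 3]] :: complex^3^3)"
          have eq: "M = C 0 ** b"
            by (simp add: vec_eq_iff forall_3 matrix_matrix_mult_def sum_3 C_def b_def)
          have "det M = det (C 0) * det b" by (subst eq) (rule det_mul)
          then have b: "b \<in> Borel3" using M(1) M21 M31 M32
            by (auto simp: Borel3_iff GL3_iff b_def a_def)
          have "p (C 0 ** b) = 0"
          proof (rule limit[where \<alpha> = "\<lambda>u. u" and \<beta> = "\<lambda>u. - (u ^ 3)"])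
            show "continuous_on UNIV (\<lambda>u. C u $ i $ j)" for i j
              using exhaust_3[of i] exhaust_3[of j]
              by (elim disjE) (simp_all add: C_def continuous_intros)
          qed (use M(1) eq b in
            \<open>auto simp: C_def algebra_simps power2_eq_square power3_eq_cube\<close>)
          then show ?thesis using eq by simp
        qed
      qed
      then show ?thesis using p(2)[OF MP] by simp
    qed
  qed
  obtain M' b where M': "M' \<in> GL3" "(matrix_inv M' ** nilp3 ** M') $ 3 $ 1 = 0"
    "b \<in> Borel3" "M = M' ** b"
    using M by (auto simp: Pet3_def flag_of_def)
  moreover have "M' \<in> \<Union>Pet3" using M' mem_flag_of by (auto simp: Pet3_def)
  ultimately show ?thesis using eq[of M' b] *[of M'] by auto
qed

section \<open>Sections along curves\<close>

text \<open>The three properties define a subspace containing every \<open>k\<close>-fold product,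
  hence the span; each factor contributes one character.\<close>

lemma R_W_properties:
  assumes "\<sigma> \<in> R_W lam k"
  shows "regular_on Pet3 \<sigma>"
    and "\<And>M b. M \<in> \<Union>Pet3 \<Longrightarrow> b \<in> Borel3 \<Longrightarrow> \<sigma> (M ** b) = weight_char lam b ^ k * \<sigma> M"
    and "\<And>M. M \<notin> \<Union>Pet3 \<Longrightarrow> \<sigma> M = 0"
proof -
  define T where "T = {\<sigma>. regular_on Pet3 \<sigma> \<and>
    (\<forall>M\<in>\<Union>Pet3. \<forall>b\<in>Borel3. \<sigma> (M ** b) = weight_char lam b ^ k * \<sigma> M) \<and>
    (\<forall>M. M \<notin> \<Union>Pet3 \<longrightarrow> \<sigma> M = 0)}"
  have sub: "fun_space.subspace T"
    unfolding fun_space.subspace_def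
  proof (intro conjI ballI allI)
    show "0 \<in> T" by (auto simp: T_def zero_fun_def regular_on_const)
    show "s + t \<in> T" if "s \<in> T" "t \<in> T" for s t
      using that by (auto simp: T_def plus_fun_def regular_on_add Pet3_subset_GL3 algebra_simps)
    show "(\<lambda>M. c * s M) \<in> T" if "s \<in> T" for c s
      using that by (auto simp: T_def regular_on_mult regular_on_const)
  qed
  have W: "regular_on Pet3 s" "\<And>M b. M \<in> \<Union>Pet3 \<Longrightarrow> b \<in> Borel3 \<Longrightarrow> s (M ** b) = weight_char lam b * s M"
    if s: "s \<in> W_sections lam" for s
  proof -
    obtain s0 where s0: "regular_GL3 s0" "equivariant_on Flags3 lam s0" "s = restrict_to Pet3 s0"
      using s by (auto simp: W_sections_def H0_Flags3_def)
    have "regular_on Pet3 s0"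
      using s0(1) Pet3_subset_GL3 unfolding regular_GL3_def regular_on_def by blast
    then show "regular_on Pet3 s"
      by (rule regular_on_cong) (simp add: s0(3) restrict_to_def)
    show "s (M ** b) = weight_char lam b * s M" if "M \<in> \<Union>Pet3" "b \<in> Borel3" for M b
    proof -
      have "M \<in> \<Union>Flags3" using that Pet3_subset_GL3 Union_Flags3 by blast
      then have "s0 (M ** b) = weight_char lam b * s0 M"
        using s0(2) that(2) unfolding equivariant_on_def by blast
      then show ?thesis
        using that(1) Union_Pet3_mult[OF that] unfolding s0(3) restrict_to_def by simp
    qed
  qed
  have "{restrict_to Pet3 (\<lambda>M. \<Prod>i<k. s i M) | s. \<forall>i<k. s i \<in> W_sections lam} \<subseteq> T"
  proof clarify
    fix s assume s: "\<forall>i<k. s i \<in> W_sections lam"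
    have "regular_on Pet3 (\<lambda>M. \<Prod>i<k. s i M)"
      using s W(1) by (intro regular_on_prod) auto
    then have "regular_on Pet3 (restrict_to Pet3 (\<lambda>M. \<Prod>i<k. s i M))"
      by (rule regular_on_cong) (simp add: restrict_to_def)
    moreover have "restrict_to Pet3 (\<lambda>M. \<Prod>i<k. s i M) (M ** b) =
        weight_char lam b ^ k * restrict_to Pet3 (\<lambda>M. \<Prod>i<k. s i M) M"
      if M: "M \<in> \<Union>Pet3" "b \<in> Borel3" for M b
    proof -
      have "(\<Prod>i<k. s i (M ** b)) = (\<Prod>i<k. weight_char lam b * s i M)"
        using s W(2)[OF _ M] by (intro prod.cong) auto
      then show ?thesis
        using M(1) Union_Pet3_mult[OF M] by (simp add: restrict_to_def prod.distrib)
    qed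
    ultimately show "restrict_to Pet3 (\<lambda>M. \<Prod>i<k. s i M) \<in> T"
      unfolding T_def by (auto simp: restrict_to_def)
  qed
  then have "\<sigma> \<in> T"
    using assms fun_space.span_minimal[OF _ sub] unfolding R_W_def by blast
  then show "regular_on Pet3 \<sigma>"
    and "\<And>M b. M \<in> \<Union>Pet3 \<Longrightarrow> b \<in> Borel3 \<Longrightarrow> \<sigma> (M ** b) = weight_char lam b ^ k * \<sigma> M"
    and "\<And>M. M \<notin> \<Union>Pet3 \<Longrightarrow> \<sigma> M = 0"
    unfolding T_def by blast+
qed

text \<open>By density of the chart. It ensures that a nonzero section has a nonzero quotient
  polynomial.\<close>

lemma R_W_zero_on_chart:
  assumes "\<sigma> \<in> R_W lam k" "\<And>x y. \<sigma> (chart x y) = 0"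
  shows "\<sigma> = 0"
proof
  fix M
  note R = R_W_properties[OF assms(1)]
  show "\<sigma> M = 0 M"
  proof (cases "M \<in> \<Union>Pet3")
    case True
    then show ?thesis
      using vanishing_on_Pet3[OF R(1) _ assms(2) True] R(2) by (auto simp: zero_fun_def)
  qed (simp add: R(3) zero_fun_def)
qed

text \<open>With constant determinant, \<open>\<sigma>\<close> is polynomial in \<open>y\<close> and
  \<open>u\<close> along the curve; equivariance moves it to the chart at the cost of
  \<open>u ^ (k * K)\<close>. So the quotient has a pole of order at most \<open>k * K\<close> at
  \<open>u = 0\<close>.\<close>

lemma quotient_along_curve:
  assumes \<sigma>: "\<sigma> \<in> R_W lam k"
    and f: "\<And>x y. eval_xy f x y = \<sigma> (chart x y) / c"
    and C: "\<And>i j. \<exists>h. \<forall>y u. C y u $ i $ j = eval_xy h y u" "\<And>y u. det (C y u) = D" "D \<noteq> 0"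
    and chart: "\<And>y u. u \<noteq> 0 \<Longrightarrow>
      \<exists>b\<in>Borel3. C y u = chart (1 / u) (g y u) ** b \<and> weight_char lam b = u ^ K"
  shows "\<exists>h. \<forall>y u. u \<noteq> 0 \<longrightarrow> u ^ (k * K) * eval_xy f (1 / u) (g y u) = eval_xy h y u"
proof -
  note R = R_W_properties[OF \<sigma>]
  obtain p n where p: "p \<in> matrix_polys" "\<And>M. M \<in> \<Union>Pet3 \<Longrightarrow> \<sigma> M = p M / det M ^ n"
    using R(1) unfolding regular_on_def by blast
  obtain h where h: "\<And>y u. p (C y u) = eval_xy h y u"
    using matrix_polys_along_curve[OF p(1) C(1)] by blast
  have "u ^ (k * K) * eval_xy f (1 / u) (g y u) = eval_xy ([:[:1 / (D ^ n * c):]:] * h) y u"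
    if u: "u \<noteq> 0" for y u
  proof -
    obtain b where b: "b \<in> Borel3" "C y u = chart (1 / u) (g y u) ** b" "weight_char lam b = u ^ K"
      using chart[OF u] by blast
    have "\<sigma> (C y u) = u ^ (k * K) * \<sigma> (chart (1 / u) (g y u))"
      unfolding b(2) R(2)[OF chart_in_Pet3 b(1)] b(3) by (simp add: power_mult[symmetric] mult.commute)
    moreover have "C y u \<in> \<Union>Pet3"
      unfolding b(2) by (rule Union_Pet3_mult[OF chart_in_Pet3 b(1)])
    ultimately have "u ^ (k * K) * \<sigma> (chart (1 / u) (g y u)) = eval_xy h y u / D ^ n"
      using p(2) h C(2) by metis
    then show ?thesis
      unfolding f eval_xy_mult eval_xy_const by simp
  qed
  then show ?thesis by blast
qed

text \<open>
  The curves \<open>C\<close> and \<open>C'\<close> below represent the flags of \<open>chart (1 / u) (y / u)\<close> and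
  \<open>chart (1 / u) (1 / u\<^sup>2 + y / u)\<close> by matrices that stay polynomial and invertible at \<open>u = 0\<close>.
\<close>

lemma quotient_weight_part_dvd:
  assumes \<sigma>: "\<sigma> \<in> R_W (lam_weight a1 a2) k"
    and f: "\<And>x y. eval_xy f x y = \<sigma> (chart x y) / c"
  shows "[:0, 1:] ^ (d - k * (2 * a1 + a2)) dvd weight_part f d"
    and "[:-1, 1:] ^ (d - k * (a1 + 2 * a2)) dvd weight_part f d"
proof -
  have poly_entries:
    "\<exists>h. \<forall>y u. y = eval_xy h y u" "\<exists>h. \<forall>y u. u = eval_xy h y u"
    "\<exists>h. \<forall>y u. - y = eval_xy h y u" "\<exists>h. \<forall>(y::complex) u. u\<^sup>2 = eval_xy h y u"
    "\<exists>h. \<forall>y u. y\<^sup>2 = eval_xy h y u" "\<exists>h. \<forall>y u. y * u + 1 = eval_xy h y u"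
    "\<exists>h. \<forall>y u. y * u - 1 = eval_xy h y u"
    "\<exists>h. \<forall>y u. eval_xy h y u = 0" "\<exists>h. \<forall>y u. eval_xy h y u = 1"
    by (rule exI[of _ "[:0, 1:]"] exI[of _ "[:[:0, 1:]:]"] exI[of _ "[:0, -1:]"]
        exI[of _ "[:[:0, 0, 1:]:]"] exI[of _ "[:0, 0, 1:]"] exI[of _ "[:1, [:0, 1:]:]"]
        exI[of _ "[:-1, [:0, 1:]:]"] exI[of _ "0"] exI[of _ "1"];
        simp add: eval_xy_def power2_eq_square)+
  \<comment> \<open>The second column is \<open>nilp3\<close> times the first; the third makes the
    determinant constant.\<close>
  define C where "C y u = (vector [vector [y, 1, 0], vector [1, u, - y], vector [u, 0, 1]] :: complex^3^3)" for y u
  have "\<exists>h. \<forall>y u. u \<noteq> 0 \<longrightarrow> u ^ (k * (2 * a1 + a2)) * eval_xy f (1 / u) (y / u) = eval_xy h y u"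
  proof (rule quotient_along_curve[OF \<sigma> f])
    show "\<exists>h. \<forall>y u. C y u $ i $ j = eval_xy h y u" for i j
      using exhaust_3[of i] exhaust_3[of j] by (elim disjE) (simp_all add: C_def poly_entries)
    show det: "det (C y u) = - 1" for y u by (simp add: C_def det_3)
    show "\<exists>b\<in>Borel3. C y u = chart (1 / u) (y / u) ** b \<and>
        weight_char (lam_weight a1 a2) b = u ^ (2 * a1 + a2)" if u: "u \<noteq> 0" for y u
    proof -
      obtain b where b: "b \<in> Borel3" "C y u = chart (1 / u) (y / u) ** b"
          "b $ 1 $ 1 = C y u $ 3 $ 1" "b $ 2 $ 2 = C y u $ 2 $ 2 - 1 / u * C y u $ 3 $ 2"
        by (rule chart_factorization[of "C y u" "1 / u" "y / u"])
           (use u in \<open>simp_all add: GL3_iff det\<close>, use u in \<open>simp_all add: C_def\<close>)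
      have "weight_char (lam_weight a1 a2) b = u ^ (2 * a1 + a2)"
        by (simp add: weight_char_lam_weight b C_def power_add mult_2)
      then show ?thesis using b by blast
    qed
  qed simp
  then obtain h where h: "\<And>y u. u \<noteq> 0 \<Longrightarrow>
      u ^ (k * (2 * a1 + a2)) * eval_xy f (1 / u) (y / u) = eval_xy h y u" by blast
  \<comment> \<open>Setting \<open>y = w / u\<close> turns \<open>y / u\<close> into
    \<open>w / u\<^sup>2\<close>, so \<open>e = 0\<close>; for \<open>C'\<close> the same
    substitution gives \<open>e = 1\<close>.\<close>
  have "[:- 0, 1:] ^ (d - k * (2 * a1 + a2)) dvd weight_part f d"
  proof (rule weight_part_dvd[of _ _ _ h])
    show "u ^ (k * (2 * a1 + a2)) * eval_xy f (1 / u) ((0 + w) / u\<^sup>2) = eval_xy h (w / u) u"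
      if "u \<noteq> 0" for u w
      using h[OF that, of "w / u"] by (simp add: power2_eq_square)
  qed
  then show "[:0, 1:] ^ (d - k * (2 * a1 + a2)) dvd weight_part f d" by simp

  \<comment> \<open>With \<open>v\<close> the first column, \<open>N v - u (1 - y u) v\<close> is
    divisible by \<open>u^3\<close>; the quotient is the second column.\<close>
  define C' where "C' y u = (vector [vector [y * u + 1, y\<^sup>2, 0], vector [u, y, 1],
    vector [u\<^sup>2, y * u - 1, 0]] :: complex^3^3)" for y u
  have "\<exists>h. \<forall>y u. u \<noteq> 0 \<longrightarrow>
      u ^ (k * (a1 + 2 * a2)) * eval_xy f (1 / u) ((y * u + 1) / u\<^sup>2) = eval_xy h y u"
  proof (rule quotient_along_curve[OF \<sigma> f])
    show "\<exists>h. \<forall>y u. C' y u $ i $ j = eval_xy h y u" for i j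
      using exhaust_3[of i] exhaust_3[of j] by (elim disjE) (simp_all add: C'_def poly_entries)
    show det: "det (C' y u) = 1" for y u
      by (simp add: C'_def det_3 algebra_simps power2_eq_square)
    show "\<exists>b\<in>Borel3. C' y u = chart (1 / u) ((y * u + 1) / u\<^sup>2) ** b \<and>
        weight_char (lam_weight a1 a2) b = u ^ (a1 + 2 * a2)" if u: "u \<noteq> 0" for y u
    proof -
      obtain b where b: "b \<in> Borel3" "C' y u = chart (1 / u) ((y * u + 1) / u\<^sup>2) ** b"
          "b $ 1 $ 1 = C' y u $ 3 $ 1" "b $ 2 $ 2 = C' y u $ 2 $ 2 - 1 / u * C' y u $ 3 $ 2"
      proof (rule chart_factorization[of "C' y u" "1 / u" "(y * u + 1) / u\<^sup>2"])
        show "C' y u \<in> GL3" by (simp add: GL3_iff det)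
        show "C' y u $ 1 $ 2 - 1 / u * C' y u $ 2 $ 2 +
            ((1 / u)\<^sup>2 - (y * u + 1) / u\<^sup>2) * C' y u $ 3 $ 2 = 0"
          using u by (simp add: C'_def field_simps power2_eq_square)
      qed (use u in \<open>auto simp: C'_def power2_eq_square\<close>)
      \<comment> \<open>The entry \<open>1 / u\<close> contributes the exponent \<open>- a1\<close>,
        so the total is \<open>2 * (a1 + a2) - a1\<close>.\<close>
      have diag: "b $ 1 $ 1 = u\<^sup>2" "b $ 2 $ 2 = 1 / u"
        using u by (simp_all add: b C'_def field_simps)
      then have "weight_char (lam_weight a1 a2) b = u ^ (a1 + 2 * a2)"
        unfolding weight_char_lam_weight diag using u
        by (simp add: power_divide power_add power_mult_distrib power2_eq_square mult_2)
      then show ?thesis using b by blast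
    qed
  qed simp
  then obtain h' where h': "\<And>y u. u \<noteq> 0 \<Longrightarrow>
      u ^ (k * (a1 + 2 * a2)) * eval_xy f (1 / u) ((y * u + 1) / u\<^sup>2) = eval_xy h' y u" by blast
  have "[:- 1, 1:] ^ (d - k * (a1 + 2 * a2)) dvd weight_part f d"
  proof (rule weight_part_dvd[of _ _ _ h'])
    show "u ^ (k * (a1 + 2 * a2)) * eval_xy f (1 / u) ((1 + w) / u\<^sup>2) = eval_xy h' (w / u) u"
      if "u \<noteq> 0" for u w
      using h'[OF that, of "w / u"] that by (simp add: add.commute)
  qed
  then show "[:-1, 1:] ^ (d - k * (a1 + 2 * a2)) dvd weight_part f d" .
qed

section \<open>The vertices\<close>

lemma low_exp_power:
  assumes "f \<noteq> 0" "low_exp f = (a, b)"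
  shows "low_exp (f ^ n) = (int n * a, int n * b)"
proof (induction n)
  case 0
  show ?case by (auto simp: low_exp_alt intro!: Least_equality)
next
  case (Suc n)
  then show ?case using assms by (simp add: low_exp_mult algebra_simps)
qed

text \<open>The last polynomial is \<open>y - x^2\<close>; as the exponent of \<open>x\<close> is
  compared first, its lowest term is \<open>y\<close>.\<close>

lemma low_exp_simps:
  "c \<noteq> 0 \<Longrightarrow> low_exp [:[:c:]:] = (0, 0)"
  "low_exp [:0, 1:] = (1, 0)"
  "low_exp [:[:0, 1:]:] = (0, 1)"
  "low_exp [:[:0, 1:], 0, -1:] = (0, 1)"
proof -
  have L: "(LEAST i. coeff p i \<noteq> 0) = n" if "coeff p n \<noteq> 0" "\<forall>i<n. coeff p i = 0"
    for p :: "'a::zero poly" and n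
    using that by (intro Least_equality) (auto simp: not_less[symmetric])
  show "c \<noteq> 0 \<Longrightarrow> low_exp [:[:c:]:] = (0, 0)"
    by (simp add: low_exp_alt L[of _ 0])
  show "low_exp [:0, 1:] = (1, 0)"
    by (simp add: low_exp_alt L[of "[:0, 1:]" 1] L[of 1 0])
  show "low_exp [:[:0, 1:]:] = (0, 1)" "low_exp [:[:0, 1:], 0, -1:] = (0, 1)"
    by (simp_all add: low_exp_alt L[of _ 0] L[of "[:0, 1:]" 1])
qed

section \<open>Global sections from matrix polynomials\<close>

lemma matrix_polys_H0_Flags3:
  assumes "s \<in> matrix_polys" "\<And>M b. b \<in> Borel3 \<Longrightarrow> s (M ** b) = weight_char lam b * s M"
  shows "restrict_to Flags3 s \<in> H0_Flags3 lam"
proof -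
  have "regular_GL3 (restrict_to Flags3 s)"
    unfolding regular_GL3_def using assms(1)
    by (intro bexI[of _ s] exI[of _ 0]) (auto simp: restrict_to_def Union_Flags3)
  moreover have "M ** b \<in> GL3" if "M \<in> GL3" "b \<in> Borel3" for M b
    using that by (auto simp: GL3_iff Borel3_iff det_mul)
  ultimately show ?thesis
    using assms(2) unfolding H0_Flags3_def equivariant_on_def
    by (auto simp: restrict_to_def Union_Flags3)
qed

lemma restrict_in_R_W_1:
  assumes "s \<in> H0_Flags3 lam"
  shows "restrict_to Pet3 s \<in> R_W lam 1"
proof -
  have "restrict_to Pet3 s = restrict_to Pet3 (\<lambda>M. \<Prod>i<(1::nat). restrict_to Pet3 s M)"
    by (auto simp: restrict_to_def fun_eq_iff)
  then show ?thesis
    unfolding R_W_def W_sections_def using assms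
    by (intro fun_space.span_base) (auto intro!: exI[of _ "\<lambda>_. restrict_to Pet3 s"])
qed

text \<open>The section is a monomial in Pluecker coordinates and \<open>D\<close>. The bounds are
  degree budgets for first-column entries and for minors; \<open>D\<close> has weight
  \<open>(2, 1, 0)\<close>, so \<open>h\<close> counts in both.\<close>

lemma exponent_attained:
  assumes "a + b + h \<le> a2" "d + e + h \<le> a1" "c \<noteq> 0"
  obtains f \<sigma> where "\<sigma> \<in> R_W (lam_weight a1 a2) 1" "\<sigma> \<noteq> 0" "f \<noteq> 0"
    "\<And>x y. eval_xy f x y = \<sigma> (chart x y) / c" "low_exp f = (int (b + e + 3 * h), int (a + d))"
proof
  \<comment> \<open>The leftover degrees go to \<open>M $ 3 $ 1\<close> and \<open>q23\<close>,
    which are \<open>1\<close> and \<open>-1\<close> on the chart.\<close>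
  define r g where "r = a2 - (a + b + h)" and "g = a1 - (d + e + h)"
  \<comment> \<open>\<open>D\<close> combines two products of equal weight whose terms
    \<open>x * y\<close> cancel on the chart, leaving \<open>x ^ 3\<close>.\<close>
  define q12 q13 q23 D :: "complex^3^3 \<Rightarrow> complex"
    where "q12 M = M $ 1 $ 1 * M $ 2 $ 2 - M $ 2 $ 1 * M $ 1 $ 2"
      and "q13 M = M $ 1 $ 1 * M $ 3 $ 2 - M $ 3 $ 1 * M $ 1 $ 2"
      and "q23 M = M $ 2 $ 1 * M $ 3 $ 2 - M $ 3 $ 1 * M $ 2 $ 2"
      and "D M = - 1 * (M $ 1 $ 1 * q13 M + M $ 2 $ 1 * q12 M)" for M
  define s :: "complex^3^3 \<Rightarrow> complex" where "s M = M $ 1 $ 1 ^ a * M $ 2 $ 1 ^ b * M $ 3 $ 1 ^ r *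
    q12 M ^ d * q13 M ^ e * q23 M ^ g * D M ^ h" for M
  have "(\<lambda>M. s M) \<in> matrix_polys"
    unfolding s_def D_def q12_def q13_def q23_def
    by (intro matrix_polys.intros matrix_polys_diff matrix_polys_power)
  moreover have "s (M ** B) = weight_char (lam_weight a1 a2) B * s M" if B: "B \<in> Borel3" for M B
  proof -
    have *: "(M ** B) $ i $ 1 = B $ 1 $ 1 * M $ i $ 1"
      "(M ** B) $ i $ 2 = B $ 1 $ 2 * M $ i $ 1 + B $ 2 $ 2 * M $ i $ 2" for i
      using B by (simp_all add: matrix_matrix_mult_def sum_3 Borel3_iff)
    have q: "q12 (M ** B) = B $ 1 $ 1 * B $ 2 $ 2 * q12 M" "q13 (M ** B) = B $ 1 $ 1 * B $ 2 $ 2 * q13 M"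
      "q23 (M ** B) = B $ 1 $ 1 * B $ 2 $ 2 * q23 M"
      unfolding q12_def q13_def q23_def * by (simp_all add: algebra_simps)
    have D: "D (M ** B) = B $ 1 $ 1 * B $ 1 $ 1 * B $ 2 $ 2 * D M"
      unfolding D_def q * by (simp add: algebra_simps)
    have "a1 + a2 = a + b + r + d + e + g + h + h" "a1 = d + e + g + h"
      using assms by (auto simp: r_def g_def)
    then have "weight_char (lam_weight a1 a2) B =
        B $ 1 $ 1 ^ (a + b + r + d + e + g + h + h) * B $ 2 $ 2 ^ (d + e + g + h)"
      using weight_char_lam_weight by metis
    then show ?thesis
      unfolding s_def q D * power_mult_distrib power_add by (simp only: mult_ac)
  qed
  ultimately have H0: "restrict_to Flags3 s \<in> H0_Flags3 (lam_weight a1 a2)"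
    by (intro matrix_polys_H0_Flags3) auto
  define \<sigma> where "\<sigma> = restrict_to Pet3 (restrict_to Flags3 s)"
  show "\<sigma> \<in> R_W (lam_weight a1 a2) 1"
    unfolding \<sigma>_def by (rule restrict_in_R_W_1[OF H0])
  \<comment> \<open>The sign comes from \<open>q13 = - x\<close> and \<open>q23 = - 1\<close> on the
    chart.\<close>
  define \<kappa> where "\<kappa> = (- 1) ^ (e + g) / c"
  let ?X = "[:0, 1:] :: complex poly poly" and ?Y = "[:[:0, 1:]:] :: complex poly poly"
    and ?Z = "[:[:0, 1:], 0, -1:] :: complex poly poly"
  define f where "f = [:[:\<kappa>:]:] * ?Y ^ a * ?Z ^ d * ?X ^ (b + e + 3 * h)"
  have \<kappa>: "\<kappa> \<noteq> 0" using assms(3) by (simp add: \<kappa>_def)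
  show "f \<noteq> 0" using \<kappa> by (simp add: f_def)
  show "low_exp f = (int (b + e + 3 * h), int (a + d))"
    using \<kappa> unfolding f_def by (simp add: low_exp_mult low_exp_power[OF _ low_exp_simps(2)]
        low_exp_power[OF _ low_exp_simps(3)] low_exp_power[OF _ low_exp_simps(4)] low_exp_simps(1)
        del: mult_pCons_left)
  have \<sigma>_chart: "\<sigma> (chart x y) = s (chart x y)" for x y
    using chart_in_Pet3 Pet3_subset_GL3 by (auto simp: \<sigma>_def restrict_to_def Union_Flags3)
  have q_chart: "q12 (chart x y) = y - x\<^sup>2" "q13 (chart x y) = - 1 * x" "q23 (chart x y) = - 1"
    "D (chart x y) = x ^ 3" for x y
    by (simp_all add: D_def q12_def q13_def q23_def chart_def power2_eq_square power3_eq_cube algebra_simps)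
  have p_chart: "chart x y $ 1 $ 1 = y" "chart x y $ 2 $ 1 = x" "chart x y $ 3 $ 1 = 1" for x y
    by (simp_all add: chart_def)
  have e1: "eval_xy ?X x y = x" "eval_xy ?Y x y = y" "eval_xy ?Z x y = y - x\<^sup>2" for x y
    by (simp_all add: eval_xy_def power2_eq_square)
  show ev: "eval_xy f x y = \<sigma> (chart x y) / c" for x y
    unfolding f_def \<sigma>_chart s_def q_chart p_chart eval_xy_mult eval_xy_power e1 eval_xy_const \<kappa>_def
      power_mult_distrib power_add power_mult
    by simp
  show "\<sigma> \<noteq> 0"
  proof
    assume "\<sigma> = 0"
    then have "eval_xy f x y = 0" for x y using ev by (simp add: zero_fun_def)
    then have "f = 0" by (intro eval_xy_eqI) (simp add: eval_xy_def)
    then show False using \<open>f \<noteq> 0\<close> by simp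
  qed
qed

section \<open>The Newton--Okounkov body\<close>

lemma mem_hull_triangle:
  fixes P Q :: "real \<times> real"
  assumes "0 \<in> V" "P \<in> V" "Q \<in> V" "0 \<le> s" "0 \<le> t" "s + t \<le> 1"
  shows "s *\<^sub>R P + t *\<^sub>R Q \<in> convex hull V"
proof -
  have "s *\<^sub>R P + t *\<^sub>R Q \<in> convex hull {0, P, Q}"
    unfolding convex_hull_3 mem_Collect_eq using assms(4-)
    by (intro exI[of _ "1 - s - t"] exI[of _ s] exI[of _ t]) simp
  then show ?thesis
    using hull_mono[of "{0, P, Q}" V convex] assms(1-3) by blast
qed

text \<open>\<open>m\<close> and \<open>n\<close> stand for the smaller and the larger of
  \<open>a1\<close> and \<open>a2\<close>. The diagonal from the origin to
  \<open>(3 * m, n - m)\<close> cuts the quadrilateral into two triangles; the case split decides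
  the side, and one outer edge inequality settles each case.\<close>

lemma mem_hull_quadrilateral:
  fixes m n \<alpha> \<beta> :: real
  assumes "0 < m" "m \<le> n" "0 \<le> \<alpha>" "0 \<le> \<beta>" "\<alpha> + \<beta> \<le> 2 * m + n" "2 * \<alpha> + 3 * \<beta> \<le> 3 * (m + n)"
    and V: "{(0, 0), (2 * m + n, 0), (0, m + n), (3 * m, n - m)} \<subseteq> V"
  shows "(\<alpha>, \<beta>) \<in> convex hull V"
proof (cases "\<alpha> * (n - m) \<le> 3 * m * \<beta>")
  case True
  \<comment> \<open>These solve the linear system expressing the point through the two nonzero
    vertices; \<open>s + t \<le> 1\<close> is the outer edge.\<close>
  define t s where "t = \<alpha> / (3 * m)" and "s = (\<beta> - t * (n - m)) / (m + n)"
  have "t * (n - m) \<le> \<beta>" using True assms(1) by (simp add: t_def field_simps)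
  then have "0 \<le> t" "0 \<le> s" using assms by (auto simp: t_def s_def)
  moreover have "s + t \<le> 1"
  proof -
    have "(s + t) * (m + n) = \<beta> + t * (2 * m)"
      using assms(1,2) by (simp add: s_def field_simps)
    also have "\<dots> = \<beta> + 2 * \<alpha> / 3" using assms(1) by (simp add: t_def)
    also have "\<dots> \<le> 1 * (m + n)" using assms(6) by simp
    finally show ?thesis using assms(1,2) by (simp add: mult_le_cancel_right)
  qed
  ultimately have "s *\<^sub>R (0, m + n) + t *\<^sub>R (3 * m, n - m) \<in> convex hull V"
    using V by (intro mem_hull_triangle) (auto simp: zero_prod_def)
  moreover have "s *\<^sub>R (0, m + n) + t *\<^sub>R (3 * m, n - m) = (\<alpha>, \<beta>)"
    using assms(1,2) by (simp add: s_def t_def)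
  ultimately show ?thesis by simp
next
  case False
  \<comment> \<open>For \<open>n = m\<close> the diagonal lies on the first axis, and no admissible
    point is below it.\<close>
  have nm: "n - m > 0"
    using False assms by (cases "n = m") auto
  define t s where "t = \<beta> / (n - m)" and "s = (\<alpha> - t * (3 * m)) / (2 * m + n)"
  have "t * (3 * m) \<le> \<alpha>" using False nm by (simp add: t_def field_simps)
  then have "0 \<le> t" "0 \<le> s" using assms nm by (auto simp: t_def s_def)
  moreover have "s + t \<le> 1"
  proof -
    have "(s + t) * (2 * m + n) = \<alpha> + t * (n - m)"
      using assms(1,2) by (simp add: s_def field_simps)
    also have "\<dots> = \<alpha> + \<beta>" using nm by (simp add: t_def)
    also have "\<dots> \<le> 1 * (2 * m + n)" using assms(5) by simp
    finally show ?thesis using assms(1,2) by (simp add: mult_le_cancel_right)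
  qed
  ultimately have "s *\<^sub>R (2 * m + n, 0) + t *\<^sub>R (3 * m, n - m) \<in> convex hull V"
    using V by (intro mem_hull_triangle) (auto simp: zero_prod_def)
  moreover have "s *\<^sub>R (2 * m + n, 0) + t *\<^sub>R (3 * m, n - m) = (\<alpha>, \<beta>)"
    using assms(1,2) nm by (simp add: s_def t_def)
  ultimately show ?thesis by simp
qed

lemma nu_polynomial:
  assumes "f \<noteq> 0"
  shows "nu (Fract f 1) = low_exp f"
proof -
  have "low_exp 1 = 0"
    using low_exp_simps(1)[of 1] by (simp add: one_pCons[symmetric] zero_prod_def)
  then show ?thesis using nu_Fract[OF assms, of 1] by simp
qed

text \<open>
  The valuations of products of Pluecker coordinates and of powers, with exponent \<open>h\<close>, of
  the section \<open>D\<close> in the proof of \<open>exponent_attained\<close>, which restricts to \<open>x\<^sup>3\<close> on the chart.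
\<close>

definition monomial_exponents :: "nat \<Rightarrow> nat \<Rightarrow> (real \<times> real) set" where
  "monomial_exponents a1 a2 = {(real (b + e + 3 * h), real (a + d)) | a b d e h.
     a + b + h \<le> a2 \<and> d + e + h \<le> a1}"

lemma monomial_exponentsI:
  assumes "a + b + h \<le> a2" "d + e + h \<le> a1" "x = real (b + e + 3 * h)" "y = real (a + d)"
  shows "(x, y) \<in> monomial_exponents a1 a2"
  using assms unfolding monomial_exponents_def by blast

text \<open>Every valuation satisfies the linear inequalities after division by \<open>k\<close>,
  while the points of \<open>V\<close> occur already at \<open>k = 1\<close>. The hull of a finite
  set is closed, so the closure adds nothing.\<close>

lemma NO_body_eqI:
  assumes \<tau>: "nowhere_vanishing_section (lam_weight a1 a2) \<tau>" and "finite V"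
    and attained: "V \<subseteq> monomial_exponents a1 a2"
    and hull: "\<And>\<alpha> \<beta>. 0 \<le> \<alpha> \<Longrightarrow> 0 \<le> \<beta> \<Longrightarrow> \<alpha> + \<beta> \<le> 2 * real a1 + real a2 \<Longrightarrow>
      \<alpha> + \<beta> \<le> real a1 + 2 * real a2 \<Longrightarrow> 2 * \<alpha> + 3 * \<beta> \<le> 3 * (real a1 + real a2) \<Longrightarrow>
      (\<alpha>, \<beta>) \<in> convex hull V"
  shows "NO_body (R_W (lam_weight a1 a2)) \<tau> = convex hull V"
proof
  obtain t where t: "\<And>x y. \<tau> (chart x y) = eval_xy t x y"
    using \<tau> unfolding nowhere_vanishing_section_def by blast
  have "chart x y \<in> \<Union>Pet3_open" for x y
    using mem_flag_of by (auto simp: Pet3_open_def)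
  then have "eval_xy t x y \<noteq> 0" for x y
    using \<tau> unfolding nowhere_vanishing_section_def t[symmetric] by blast
  then obtain c where c: "c \<noteq> 0" "\<And>x y. \<tau> (chart x y) = c"
    using eval_xy_nonvanishing_const[of t] t by metis
  let ?S = "\<Union>k\<in>{1..}. {(1 / real k) *\<^sub>R real_pair (nu (Fract f 1)) | f \<sigma>.
        \<sigma> \<in> R_W (lam_weight a1 a2) k \<and> \<sigma> \<noteq> 0 \<and> is_quotient f \<sigma> \<tau> k}"
  have "?S \<subseteq> convex hull V"
  proof (rule subsetI, elim UN_E CollectE exE conjE)
    fix v k f \<sigma> assume k: "k \<in> {1::nat..}" and \<sigma>: "\<sigma> \<in> R_W (lam_weight a1 a2) k" "\<sigma> \<noteq> 0"
      and v: "v = (1 / real k) *\<^sub>R real_pair (nu (Fract f 1))" and "is_quotient f \<sigma> \<tau> k"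
    then have f: "eval_xy f x y = \<sigma> (chart x y) / c ^ k" for x y
      by (simp add: is_quotient_def c)
    have f0: "f \<noteq> 0"
    proof
      assume "f = 0"
      then have "\<sigma> (chart x y) = 0" for x y using f[of x y] c by (simp add: eval_xy_def)
      then show False using R_W_zero_on_chart[OF \<sigma>(1)] \<sigma>(2) by blast
    qed
    obtain \<alpha> \<beta> where le: "low_exp f = (int \<alpha>, int \<beta>)" by (simp add: low_exp_alt)
    have "(\<alpha> + 2 * \<beta> - k * (2 * a1 + a2)) + (\<alpha> + 2 * \<beta> - k * (a1 + 2 * a2)) \<le> \<beta>"
      using low_exp_bound[OF f0 le] quotient_weight_part_dvd[OF \<sigma>(1) f] by blast
    \<comment> \<open>Subtraction truncates at zero: each summand alone gives one of the first two
      bounds, and their sum gives the third, whose right side is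
      \<open>3 * k * (a1 + a2)\<close>.\<close>
    then have "\<alpha> + \<beta> \<le> k * (2 * a1 + a2)" "\<alpha> + \<beta> \<le> k * (a1 + 2 * a2)"
      "2 * \<alpha> + 3 * \<beta> \<le> k * (2 * a1 + a2) + k * (a1 + 2 * a2)"
      by linarith+
    then have "real (\<alpha> + \<beta>) \<le> real (k * (2 * a1 + a2))" "real (\<alpha> + \<beta>) \<le> real (k * (a1 + 2 * a2))"
      "real (2 * \<alpha> + 3 * \<beta>) \<le> real (k * (2 * a1 + a2) + k * (a1 + 2 * a2))"
      by (simp_all only: of_nat_le_iff)
    then have "(\<alpha> / k, \<beta> / k) \<in> convex hull V"
      using k by (intro hull) (simp_all add: field_simps)
    then show "v \<in> convex hull V"
      by (simp add: v nu_polynomial[OF f0] le real_pair_def)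
  qed
  then have "convex hull ?S \<subseteq> convex hull V" by (simp add: hull_minimal)
  moreover have "closed (convex hull V)"
    using \<open>finite V\<close> by (intro compact_imp_closed compact_convex_hull finite_imp_compact)
  ultimately show "NO_body (R_W (lam_weight a1 a2)) \<tau> \<subseteq> convex hull V"
    unfolding NO_body_def by (rule closure_minimal)
  have "V \<subseteq> ?S"
  proof
    fix v assume "v \<in> V"
    then obtain a b d e h where *: "a + b + h \<le> a2" "d + e + h \<le> a1"
      and v: "v = (real (b + e + 3 * h), real (a + d))" using attained
      unfolding monomial_exponents_def by blast
    obtain f \<sigma> where \<sigma>: "\<sigma> \<in> R_W (lam_weight a1 a2) 1" "\<sigma> \<noteq> 0" "f \<noteq> 0"
      "\<And>x y. eval_xy f x y = \<sigma> (chart x y) / c" "low_exp f = (int (b + e + 3 * h), int (a + d))"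
      using exponent_attained[OF * c(1)] by metis
    have "v = (1 / real 1) *\<^sub>R real_pair (nu (Fract f 1))"
      by (simp add: nu_polynomial[OF \<sigma>(3)] \<sigma>(5) real_pair_def v)
    moreover have "is_quotient f \<sigma> \<tau> 1" by (simp add: is_quotient_def \<sigma>(4) c)
    ultimately show "v \<in> ?S" using \<sigma>(1,2) by blast
  qed
  then show "convex hull V \<subseteq> NO_body (R_W (lam_weight a1 a2)) \<tau>"
    unfolding NO_body_def by (meson hull_mono closure_subset order_trans)
qed

theorem theorem7p6:
  fixes a1 a2 :: nat and \<tau> :: "complex^3^3 \<Rightarrow> complex"
  assumes "0 < a1" and "0 < a2"
    and "nowhere_vanishing_section (lam_weight a1 a2) \<tau>"
  shows "(a1 \<ge> a2 \<longrightarrow>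
      NO_body (R_W (lam_weight a1 a2)) \<tau> =
        convex hull {(0, 0), (2 * real a2 + real a1, 0), (0, real a1 + real a2),
          (3 * real a2, real a1 - real a2)}) \<and>
    (a2 \<ge> a1 \<longrightarrow>
      NO_body (R_W (lam_weight a1 a2)) \<tau> =
        convex hull {(0, 0), (0, real a1 + real a2), (2 * real a1 + real a2, 0),
          (3 * real a1, real a2 - real a1)})"
proof (intro conjI impI)
  assume le: "a2 \<le> a1"
  show "NO_body (R_W (lam_weight a1 a2)) \<tau> =
      convex hull {(0, 0), (2 * real a2 + real a1, 0), (0, real a1 + real a2),
        (3 * real a2, real a1 - real a2)}" (is "_ = convex hull ?V")
  proof (rule NO_body_eqI[OF assms(3)])
    \<comment> \<open>On the chart the four instances are, up to constants, \<open>1\<close>,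
      \<open>y^a2 (y - x^2)^a1\<close>, \<open>x^(2 a2 + a1)\<close> and
      \<open>x^(3 a2) (y - x^2)^(a1 - a2)\<close>.\<close>
    show "?V \<subseteq> monomial_exponents a1 a2"
      using le monomial_exponentsI[of 0 0 0 a2 0 0 a1] monomial_exponentsI[of a2 0 0 a2 a1 0 a1]
        monomial_exponentsI[of 0 0 a2 a2 0 "a1 - a2" a1] monomial_exponentsI[of 0 0 a2 a2 "a1 - a2" 0 a1]
      by (simp add: of_nat_diff add.commute)
    show "(\<alpha>, \<beta>) \<in> convex hull ?V"
      if "0 \<le> \<alpha>" "0 \<le> \<beta>" "\<alpha> + \<beta> \<le> 2 * real a1 + real a2"
        "\<alpha> + \<beta> \<le> real a1 + 2 * real a2" "2 * \<alpha> + 3 * \<beta> \<le> 3 * (real a1 + real a2)" for \<alpha> \<beta>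
      using that assms le by (intro mem_hull_quadrilateral[of "real a2" "real a1"]) auto
  qed simp
next
  assume le: "a1 \<le> a2"
  show "NO_body (R_W (lam_weight a1 a2)) \<tau> =
      convex hull {(0, 0), (0, real a1 + real a2), (2 * real a1 + real a2, 0),
        (3 * real a1, real a2 - real a1)}" (is "_ = convex hull ?V")
  proof (rule NO_body_eqI[OF assms(3)])
    \<comment> \<open>The last two instances are now \<open>x^(2 a1 + a2)\<close> and
      \<open>x^(3 a1) y^(a2 - a1)\<close>, up to constants.\<close>
    show "?V \<subseteq> monomial_exponents a1 a2"
      using le monomial_exponentsI[of 0 0 0 a2 0 0 a1] monomial_exponentsI[of a2 0 0 a2 a1 0 a1]
        monomial_exponentsI[of 0 "a2 - a1" a1 a2 0 0 a1] monomial_exponentsI[of "a2 - a1" 0 a1 a2 0 0 a1]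
      by (simp add: of_nat_diff add.commute)
    show "(\<alpha>, \<beta>) \<in> convex hull ?V"
      if "0 \<le> \<alpha>" "0 \<le> \<beta>" "\<alpha> + \<beta> \<le> 2 * real a1 + real a2"
        "\<alpha> + \<beta> \<le> real a1 + 2 * real a2" "2 * \<alpha> + 3 * \<beta> \<le> 3 * (real a1 + real a2)" for \<alpha> \<beta>
      using that assms le by (intro mem_hull_quadrilateral[of "real a1" "real a2"]) auto
  qed simp
qed

end
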